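(* Let $k\in\mathbb R$ and let $X$ be a complete Alexandrov space with curvature $\geq k$. Let $p\in X$ and let $[qr]\subset X$ be a minimal geodesic, and let $\tilde p\in\mathbb S^2_k$ and $[\tilde q\tilde r]\subset\mathbb S^2_k$ be such that $|\tilde p\tilde q|=|pq|$, $|\tilde p\tilde r|=|pr|$, $|\tilde q\tilde r|=|qr|$. Suppose that $|pq|+|pr|+|qr|<\frac{2\pi}{\sqrt k}$ if $k>0$. Then for any $s\in[qr]$ and $\tilde s\in[\tilde q\tilde r]$ with $|qs|=|\tilde q\tilde s|$, we have $|ps|\ge|\tilde p\tilde s|$.
   Context: $\mathbb S^2_k$ is the complete simply connected $2$-dimensional Riemannian manifold of constant curvature $k$. $|xy|$ is the distance between $x$ and $y$, and $[xy]$ denotes a minimal geodesic (shortest path) between $x$ and $y$. An Alexandrov space with curvature $\ge k$ is a locally compact length space $X$ on which the Toponogov comparison holds locally: every point of $X$ has a neighborhood $U$ such that for any $p\in U$ and any minimal geodesic $[qr]\subset U$ (with $|pq|+|pr|+|qr|<\frac{2\pi}{\sqrt k}$ if $k>0$), and $\tilde p\in\mathbb S^2_k$, $[\tilde q\tilde r]\subset\mathbb S^2_k$ with $|\tilde p\tilde q|=|pq|$, $|\tilde p\tilde r|=|pr|$, $|\tilde q\tilde r|=|qr|$, one has $|ps|\ge|\tilde p\tilde s|$ for all $s\in[qr]$ and $\tilde s\in[\tilde q\tilde r]$ with $|qs|=|\tilde q\tilde s|$. *)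

theory Defs
  imports "HOL-Analysis.Analysis"
begin

definition curve_length :: "('a \<Rightarrow> 'a \<Rightarrow> real) \<Rightarrow> (real \<Rightarrow> 'a) \<Rightarrow> ereal" where
  "curve_length d g =
     (SUP (n, t) \<in> {(n :: nat, t :: nat \<Rightarrow> real). mono_on {..n} t \<and> t ` {..n} \<subseteq> {0..1}}.
        ereal (\<Sum>i<n. d (g (t i)) (g (t (Suc i)))))"

definition curves_between :: "'a set \<Rightarrow> ('a \<Rightarrow> 'a \<Rightarrow> real) \<Rightarrow> 'a \<Rightarrow> 'a \<Rightarrow> (real \<Rightarrow> 'a) set" where
  "curves_between M d x y =
     {g. pathin (Metric_space.mtopology M d) g \<and> g 0 = x \<and> g 1 = y}"

definition length_space :: "'a set \<Rightarrow> ('a \<Rightarrow> 'a \<Rightarrow> real) \<Rightarrow> bool" where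
  "length_space M d \<longleftrightarrow> Metric_space M d \<and>
     (\<forall>x\<in>M. \<forall>y\<in>M. ereal (d x y) = (INF g \<in> curves_between M d x y. curve_length d g))"

text \<open>\<open>S\<close> is the point set of a shortest path; \<open>x, y \<in> M\<close> follows from \<^const>\<open>pathin\<close>.\<close>

definition min_geodesic :: "'a set \<Rightarrow> ('a \<Rightarrow> 'a \<Rightarrow> real) \<Rightarrow> 'a \<Rightarrow> 'a \<Rightarrow> 'a set \<Rightarrow> bool" where
  "min_geodesic M d x y S \<longleftrightarrow>
     (\<exists>g \<in> curves_between M d x y. curve_length d g = ereal (d x y) \<and> S = g ` {0..1})"

definition mink :: "real^3 \<Rightarrow> real^3 \<Rightarrow> real" where
  "mink x y = x$1 * y$1 + x$2 * y$2 - x$3 * y$3"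

text \<open>For \<open>k > 0\<close> this is the round sphere of radius \<open>1 / sqrt k\<close>, for \<open>k = 0\<close> the Euclidean plane,
  and for \<open>k < 0\<close> the upper sheet of the hyperboloid \<open>mink x x = 1 / k\<close> in Minkowski space.\<close>

definition model_plane :: "real \<Rightarrow> (real^3) set" where
  "model_plane k =
     (if k > 0 then {x. x \<bullet> x = 1 / k}
      else if k = 0 then {x. x$3 = 0}
      else {x. mink x x = 1 / k \<and> x$3 > 0})"

text \<open>The Riemannian distance of the metric induced by the ambient (Euclidean or Minkowski) form.
  The value \<open>0\<close> off the model plane makes \<^locale>\<open>Metric_space\<close> applicable, which
  asks for a nonnegative function on the whole type.\<close>

definition model_dist :: "real \<Rightarrow> real^3 \<Rightarrow> real^3 \<Rightarrow> real" where
  "model_dist k x y =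
     (if x \<in> model_plane k \<and> y \<in> model_plane k
      then if k > 0 then arccos (k * (x \<bullet> y)) / sqrt k
           else if k = 0 then dist x y
           else arcosh (k * mink x y) / sqrt (- k)
      else 0)"

lemma inner_real3: "(x :: real^3) \<bullet> y = x$1 * y$1 + x$2 * y$2 + x$3 * y$3"
  by (simp add: inner_vec_def sum_3)

lemma gram_inner:
  fixes x y z :: "real^3"
  shows "(x \<bullet> x) * (y \<bullet> y) * (z \<bullet> z) + 2 * (x \<bullet> y) * (y \<bullet> z) * (x \<bullet> z)
    - (x \<bullet> x) * (y \<bullet> z)\<^sup>2 - (y \<bullet> y) * (x \<bullet> z)\<^sup>2 - (z \<bullet> z) * (x \<bullet> y)\<^sup>2
    = (x$1 * (y$2 * z$3 - y$3 * z$2) - x$2 * (y$1 * z$3 - y$3 * z$1)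
       + x$3 * (y$1 * z$2 - y$2 * z$1))\<^sup>2"
  unfolding inner_real3 by algebra

lemma gram_mink:
  "mink x x * mink y y * mink z z + 2 * mink x y * mink y z * mink x z
    - mink x x * (mink y z)\<^sup>2 - mink y y * (mink x z)\<^sup>2 - mink z z * (mink x y)\<^sup>2
    = - (x$1 * (y$2 * z$3 - y$3 * z$2) - x$2 * (y$1 * z$3 - y$3 * z$1)
       + x$3 * (y$1 * z$2 - y$2 * z$1))\<^sup>2"
  unfolding mink_def by algebra

lemma mink_commute: "mink x y = mink y x"
  by (simp add: mink_def)

lemma model_plane_pos_abs_le:
  assumes "k > 0" "x \<in> model_plane k" "y \<in> model_plane k"
  shows "\<bar>k * (x \<bullet> y)\<bar> \<le> 1"
proof -
  have "norm x * norm y = 1 / k"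
    using assms by (simp add: model_plane_def norm_eq_sqrt_inner flip: real_sqrt_mult)
  then have "\<bar>x \<bullet> y\<bar> \<le> 1 / k"
    using Cauchy_Schwarz_ineq2[of x y] by simp
  then show ?thesis
    using assms(1) by (simp add: abs_mult field_simps)
qed

lemma model_plane_neg_ge_1:
  assumes k: "k < 0" and x: "x \<in> model_plane k" and y: "y \<in> model_plane k"
  shows "k * mink x y \<ge> 1" and "k * mink x y = 1 \<Longrightarrow> x = y"
proof -
  define r where "r = - 1 / k"
  have r: "r > 0" using k by (simp add: r_def field_simps)
  have xx: "(x$3)\<^sup>2 = r + (x$1)\<^sup>2 + (x$2)\<^sup>2" and x3: "x$3 > 0"
    using k x by (auto simp: model_plane_def mink_def r_def power2_eq_square)
  have yy: "(y$3)\<^sup>2 = r + (y$1)\<^sup>2 + (y$2)\<^sup>2" and y3: "y$3 > 0"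
    using k y by (auto simp: model_plane_def mink_def r_def power2_eq_square)
  define c where "c = r + x$1 * y$1 + x$2 * y$2"
  define e where "e = r * ((x$1 - y$1)\<^sup>2 + (x$2 - y$2)\<^sup>2) + (x$1 * y$2 - x$2 * y$1)\<^sup>2"
  have id: "(x$3 * y$3)\<^sup>2 = c\<^sup>2 + e"
    unfolding power_mult_distrib xx yy c_def e_def by algebra
  have e0: "e \<ge> 0" using r by (simp add: e_def)
  have "c \<le> x$3 * y$3"
    by (rule power2_le_imp_le) (use id e0 x3 y3 in auto)
  then have m: "- mink x y \<ge> r"
    by (simp add: mink_def c_def)
  have kr: "k * (- r) = 1" using k by (simp add: r_def)
  show "k * mink x y \<ge> 1"
    using mult_left_mono_neg[of "mink x y" "- r" k] m k kr by linarith
  assume "k * mink x y = 1"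
  then have "mink x y = - r" using kr k by (metis mult_cancel_left less_irrefl)
  then have "c = x$3 * y$3" by (simp add: mink_def c_def)
  then have "e = 0" using id by simp
  then have "(x$1 - y$1)\<^sup>2 + (x$2 - y$2)\<^sup>2 = 0"
    using r unfolding e_def
    by (smt (verit) mult_pos_pos zero_le_power2)
  then have 12: "x$1 = y$1" "x$2 = y$2"
    by (simp_all add: sum_power2_eq_zero_iff)
  then have "(x$3)\<^sup>2 = (y$3)\<^sup>2" using xx yy by simp
  then have "x$3 = y$3" using x3 y3 by (simp add: power2_eq_iff)
  with 12 show "x = y" by (simp add: vec_eq_iff forall_3)
qed

lemma model_triangle_pos:
  assumes k: "k > 0" and xyz: "x \<in> model_plane k" "y \<in> model_plane k" "z \<in> model_plane k"
  shows "arccos (k * (x \<bullet> z)) \<le> arccos (k * (x \<bullet> y)) + arccos (k * (y \<bullet> z))"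
proof -
  define A B C where "A = k * (x \<bullet> y)" and "B = k * (y \<bullet> z)" and "C = k * (x \<bullet> z)"
  have abs: "\<bar>A\<bar> \<le> 1" "\<bar>B\<bar> \<le> 1" "\<bar>C\<bar> \<le> 1"
    unfolding A_def B_def C_def using model_plane_pos_abs_le k xyz by blast+
  have 1: "k * (x \<bullet> x) = 1" "k * (y \<bullet> y) = 1" "k * (z \<bullet> z) = 1"
    using k xyz by (simp_all add: model_plane_def)
  have "1 + 2 * A * B * C - A\<^sup>2 - B\<^sup>2 - C\<^sup>2
    = k ^ 3 * ((x \<bullet> x) * (y \<bullet> y) * (z \<bullet> z) + 2 * (x \<bullet> y) * (y \<bullet> z) * (x \<bullet> z)
    - (x \<bullet> x) * (y \<bullet> z)\<^sup>2 - (y \<bullet> y) * (x \<bullet> z)\<^sup>2 - (z \<bullet> z) * (x \<bullet> y)\<^sup>2)"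
    unfolding A_def B_def C_def using 1 by algebra
  also have "\<dots> \<ge> 0" unfolding gram_inner using k by simp
  finally have "(A * B - C)\<^sup>2 \<le> (1 - A\<^sup>2) * (1 - B\<^sup>2)"
    by (simp add: power2_eq_square algebra_simps)
  then have "A * B - C \<le> sqrt ((1 - A\<^sup>2) * (1 - B\<^sup>2))"
    by (rule real_le_rsqrt)
  then have C: "cos (arccos A + arccos B) \<le> C"
    using abs by (simp add: cos_add cos_arccos_abs sin_arccos_abs real_sqrt_mult)
  have nn: "arccos A \<ge> 0" "arccos B \<ge> 0" "arccos C \<le> pi"
    using abs by (auto intro: arccos_lbound arccos_ubound simp: abs_le_iff)
  have "arccos C \<le> arccos A + arccos B"
  proof (cases "arccos A + arccos B \<le> pi")
    case True
    have "arccos C \<le> arccos (cos (arccos A + arccos B))"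
      using C abs by (intro arccos_le_mono[THEN iffD2]) auto
    then show ?thesis using True nn by (simp add: arccos_cos)
  qed (use nn in linarith)
  then show ?thesis by (simp add: A_def B_def C_def)
qed

lemma model_triangle_neg:
  assumes k: "k < 0" and xyz: "x \<in> model_plane k" "y \<in> model_plane k" "z \<in> model_plane k"
  shows "arcosh (k * mink x z) \<le> arcosh (k * mink x y) + arcosh (k * mink y z)"
proof -
  define A B C where "A = k * mink x y" and "B = k * mink y z" and "C = k * mink x z"
  have ge: "A \<ge> 1" "B \<ge> 1" "C \<ge> 1"
    unfolding A_def B_def C_def using model_plane_neg_ge_1 k xyz by blast+
  have 1: "k * mink x x = 1" "k * mink y y = 1" "k * mink z z = 1"
    using k xyz by (simp_all add: model_plane_def)
  have "1 + 2 * A * B * C - A\<^sup>2 - B\<^sup>2 - C\<^sup>2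
    = k ^ 3 * (mink x x * mink y y * mink z z + 2 * mink x y * mink y z * mink x z
    - mink x x * (mink y z)\<^sup>2 - mink y y * (mink x z)\<^sup>2 - mink z z * (mink x y)\<^sup>2)"
    unfolding A_def B_def C_def using 1 by algebra
  also have "\<dots> \<ge> 0" unfolding gram_mink
    using k by (intro mult_nonpos_nonpos) (auto simp: power3_eq_cube mult_nonneg_nonpos)
  finally have "(C - A * B)\<^sup>2 \<le> (A\<^sup>2 - 1) * (B\<^sup>2 - 1)"
    by (simp add: power2_eq_square algebra_simps)
  then have "C - A * B \<le> sqrt ((A\<^sup>2 - 1) * (B\<^sup>2 - 1))"
    by (rule real_le_rsqrt)
  then have C: "C \<le> cosh (arcosh A + arcosh B)"
    using ge by (simp add: cosh_add sinh_arcosh_real real_sqrt_mult)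
  have nn: "arcosh A \<ge> 0" "arcosh B \<ge> 0" using ge by simp_all
  have "cosh (arcosh C) \<le> cosh (arcosh A + arcosh B)" using C ge by simp
  then have "arcosh C \<le> arcosh A + arcosh B"
    using ge nn by (subst (asm) cosh_real_nonneg_le_iff) auto
  then show ?thesis by (simp add: A_def B_def C_def)
qed

lemma Metric_space_model: "Metric_space (model_plane k) (model_dist k)"
proof
  fix x y
  show "0 \<le> model_dist k x y"
    using model_plane_pos_abs_le[of k x y] model_plane_neg_ge_1(1)[of k x y]
    by (auto simp: model_dist_def abs_le_iff intro!: divide_nonneg_nonneg arccos_lbound)
  show "model_dist k x y = model_dist k y x"
    by (auto simp: model_dist_def mink_commute inner_commute dist_commute)
next
  fix x y assume xy: "x \<in> model_plane k" "y \<in> model_plane k"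
  consider "k > 0" | "k = 0" | "k < 0" by linarith
  then show "(model_dist k x y = 0) = (x = y)"
  proof cases
    case 1
    have xx: "x \<bullet> x = 1 / k" "y \<bullet> y = 1 / k" using xy 1 by (simp_all add: model_plane_def)
    have "x = y" if "arccos (k * (x \<bullet> y)) = 0"
    proof -
      have "k * (x \<bullet> y) = 1"
        using cos_arccos_abs[OF model_plane_pos_abs_le[OF 1 xy]] that by simp
      then have "x \<bullet> y = 1 / k" using 1 by (simp add: field_simps)
      then have "(x - y) \<bullet> (x - y) = 0"
        using xx by (simp add: inner_diff inner_commute)
      then show ?thesis by simp
    qed
    then show ?thesis using 1 xy xx by (auto simp: model_dist_def)
  next
    case 3
    then show ?thesis
      using xy model_plane_neg_ge_1[OF 3 xy] by (auto simp: model_dist_def model_plane_def)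
  qed (use xy in \<open>simp add: model_dist_def\<close>)
next
  fix x y z assume xyz: "x \<in> model_plane k" "y \<in> model_plane k" "z \<in> model_plane k"
  then show "model_dist k x z \<le> model_dist k x y + model_dist k y z"
    using model_triangle_pos[OF _ xyz] model_triangle_neg[OF _ xyz]
    by (auto simp: model_dist_def dist_triangle add_divide_distrib[symmetric] divide_right_mono)
qed

definition alexandrov_space :: "real \<Rightarrow> 'a set \<Rightarrow> ('a \<Rightarrow> 'a \<Rightarrow> real) \<Rightarrow> bool" where
  "alexandrov_space k M d \<longleftrightarrow>
     length_space M d \<and> locally_compact_space (Metric_space.mtopology M d) \<and>
     (\<forall>x\<in>M. \<exists>U. openin (Metric_space.mtopology M d) U \<and> x \<in> U \<and>
       (\<forall>p\<in>U. \<forall>q r S. min_geodesic M d q r S \<and> S \<subseteq> U \<and>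
          (k > 0 \<longrightarrow> d p q + d p r + d q r < 2 * pi / sqrt k) \<longrightarrow>
          (\<forall>p'\<in>model_plane k. \<forall>q' r' S'.
             min_geodesic (model_plane k) (model_dist k) q' r' S' \<and>
             model_dist k p' q' = d p q \<and> model_dist k p' r' = d p r \<and>
             model_dist k q' r' = d q r \<longrightarrow>
             (\<forall>s\<in>S. \<forall>s'\<in>S'. d q s = model_dist k q' s' \<longrightarrow> d p s \<ge> model_dist k p' s'))))"

end

theory Submission
  imports Defs
begin

text \<open>Write \<open>md\<close> for the solution of \<open>y'' + k y = 1\<close> with \<open>y(0) = y'(0) = 0\<close>. Along a geodesic of the
  model plane of curvature \<open>k\<close>, \<open>md\<close> of the distance to a fixed point solves the same equation, and
  the law of cosines becomes affine in the cosine of the angle, with the same formula for every sign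
  of \<open>k\<close>. The comparison for a triangle \<open>p, q, r\<close> therefore says that \<open>md\<close> of the distance to \<open>p\<close>,
  along the side \<open>[qr]\<close>, lies above the solution of \<open>y'' + k y = 1\<close> with the same values at \<open>q\<close> and
  \<open>r\<close>. Evaluated at one point of the side this is the inequality \<open>stewart_le\<close>, in which the model
  plane no longer occurs (\<open>stewart_model\<close>, \<open>alexandrov_comparison_ball\<close>).

  In a small ball the hypothesis makes the comparison angle of a hinge a monotone function of its
  side lengths. So angles exist, short hinges satisfy the hinge comparison (the distance of the
  endpoints is at most that of the model hinge with the same angle), and adjacent angles add up to at
  most \<open>\<pi>\<close> (\<open>angle_cos_tendsto\<close>, \<open>angle_cos_le\<close>, \<open>angle_cos_adjacent\<close>).

  The passage from local to global is \<open>short_hinge\<close>: if hinges of total length below \<open>2 l / 3\<close> satisfy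
  the comparison, then so do those of total length below \<open>l\<close>. A hinge at \<open>x\<close> with endpoints \<open>p, q\<close> is
  replaced by a hinge at a point \<open>x'\<close> of its longer side, with the same endpoints. Comparing the
  small hinges of the triangle \<open>p, x, x'\<close> shows that neither the total length nor the model distance
  of the endpoints increases. Either the length drops by a definite amount, which can happen only
  finitely often, or the hinge is almost straight, and then the model distance is almost its total
  length, which bounds \<open>|pq|\<close>. By the theorem of Hopf and Rinow balls are compact, so that on a given
  ball all hinges up to some positive size satisfy the comparison; finitely many enlargements by the
  factor \<open>3 / 2\<close> give it for hinges of any total length, less than \<open>\<pi> / sqrt k\<close> if \<open>k > 0\<close>.

  From hinges back to triangles: at an interior point \<open>u\<close> of \<open>[qr]\<close>, the two hinges formed by \<open>[up]\<close>
  and short pieces of \<open>[qr]\<close>, together with the bound on adjacent angles, give a solution of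
  \<open>y'' + k y = 1\<close> that supports \<open>md\<close> of the distance to \<open>p\<close> from above at \<open>u\<close> (\<open>distance_barrier\<close>).
  A maximum principle (\<open>barrier_nonneg\<close>) turns these supports into the comparison on all of \<open>[qr]\<close>.
  As one side of each hinge is arbitrarily short, the only requirement for \<open>k > 0\<close> is
  \<open>|pu| < \<pi> / sqrt k\<close>, which is what the bound on the perimeter provides.\<close>

section \<open>Trigonometry of constant curvature\<close>

definition cs :: "real \<Rightarrow> real \<Rightarrow> real" where
  "cs k t = (if k > 0 then cos (sqrt k * t) else if k = 0 then 1 else cosh (sqrt (- k) * t))"

definition sn :: "real \<Rightarrow> real \<Rightarrow> real" where
  "sn k t = (if k > 0 then sin (sqrt k * t) / sqrt k else if k = 0 then t
     else sinh (sqrt (- k) * t) / sqrt (- k))"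

definition md :: "real \<Rightarrow> real \<Rightarrow> real" where
  "md k t = (if k = 0 then t\<^sup>2 / 2 else (1 - cs k t) / k)"

text \<open>For \<open>k > 0\<close> the model plane has diameter \<open>pi / sqrt k\<close>, the first positive zero of \<open>sn k\<close>.\<close>

definition below_diameter :: "real \<Rightarrow> real \<Rightarrow> bool" where
  "below_diameter k t \<longleftrightarrow> (k > 0 \<longrightarrow> t < pi / sqrt k)"

lemma below_diameter_mono: "below_diameter k t \<Longrightarrow> s \<le> t \<Longrightarrow> below_diameter k s"
  by (auto simp: below_diameter_def)

lemma cs_md: "cs k t = 1 - k * md k t"
  by (simp add: md_def cs_def)

lemma sn_cs_md_zero [simp]: "cs k 0 = 1" "sn k 0 = 0" "md k 0 = 0"
  by (simp_all add: cs_def sn_def md_def)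

lemma sn_cs_md_minus [simp]: "cs k (- t) = cs k t" "sn k (- t) = - sn k t" "md k (- t) = md k t"
  by (simp_all add: cs_def sn_def md_def)

lemma md_abs [simp]: "md k \<bar>t\<bar> = md k t"
  by (simp add: abs_if)

lemma cs_add: "cs k (s + t) = cs k s * cs k t - k * (sn k s * sn k t)"
  by (simp add: cs_def sn_def distrib_left cos_add cosh_add)

lemma sn_add: "sn k (s + t) = sn k s * cs k t + cs k s * sn k t"
  by (simp add: cs_def sn_def distrib_left sin_add sinh_add add_divide_distrib)

lemma md_add: "md k (s + t) = md k t + cs k t * md k s + sn k s * sn k t"
proof (cases "k = 0")
  case True
  then show ?thesis by (simp add: md_def cs_def sn_def power2_eq_square algebra_simps)
next
  case False
  have "k * md k (s + t) = k * (md k t + cs k t * md k s + sn k s * sn k t)"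
    using cs_add[of k s t] unfolding cs_md by (simp add: algebra_simps)
  with False show ?thesis by simp
qed

lemma sn_square: "(sn k t)\<^sup>2 = 2 * md k t - k * (md k t)\<^sup>2"
proof (cases "k = 0")
  case True
  then show ?thesis by (simp add: md_def sn_def)
next
  case False
  have "k * (sn k t)\<^sup>2 = 1 - (cs k t)\<^sup>2"
    using False cosh_square_eq[of "sqrt (-k) * t"] 
    by (auto simp: cs_def sn_def power_divide sin_squared_eq divide_simps)
  then have "k * (sn k t)\<^sup>2 = k * (2 * md k t - k * (md k t)\<^sup>2)"
    unfolding cs_md by (simp add: power2_eq_square algebra_simps)
  with False show ?thesis by simp
qed

lemma sn_pos:
  assumes "0 < t" "below_diameter k t" shows "sn k t > 0"
proof -
  have "sin (sqrt k * t) > 0" if "k > 0"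
    using that assms by (intro sin_gt_zero) (auto simp: below_diameter_def field_simps)
  then show ?thesis using assms by (cases "k = 0") (auto simp: sn_def)
qed

lemma sn_nonneg: "0 \<le> t \<Longrightarrow> below_diameter k t \<Longrightarrow> sn k t \<ge> 0"
  using sn_pos[of t k] by (cases "t = 0") auto

lemma DERIV_md [derivative_intros]: "(md k has_real_derivative sn k t) (at t)"
proof -
  consider "k > 0" | "k = 0" | "k < 0" by linarith
  then show ?thesis
  proof cases
    case 1
    then have "md k = (\<lambda>t. (1 - cos (sqrt k * t)) / k)" by (auto simp: md_def cs_def fun_eq_iff)
    moreover have "((\<lambda>t. (1 - cos (sqrt k * t)) / k) has_real_derivative (sin (sqrt k * t) * sqrt k) / k) (at t)"
      using 1 by (auto intro!: derivative_eq_intros)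
    moreover have "(sin (sqrt k * t) * sqrt k) / k = sn k t"
      using 1 by (simp add: sn_def frac_eq_eq less_imp_neq[symmetric])
    ultimately show ?thesis by simp
  next
    case 2
    then have "md k = (\<lambda>t. t\<^sup>2 / 2)" by (auto simp: md_def fun_eq_iff)
    then show ?thesis using 2 by (auto intro!: derivative_eq_intros simp: sn_def)
  next
    case 3
    then have "md k = (\<lambda>t. (1 - cosh (sqrt (-k) * t)) / k)" by (auto simp: md_def cs_def fun_eq_iff)
    moreover have "((\<lambda>t. (1 - cosh (sqrt (-k) * t)) / k) has_real_derivative - (sinh (sqrt (-k) * t) * sqrt (-k)) / k) (at t)"
      using 3 by (auto intro!: derivative_eq_intros)
    moreover have "- (sinh (sqrt (-k) * t) * sqrt (-k)) / k = sn k t"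
    proof -
      have "- (h * S) / k = h / S" if "S > 0" "k = - (S * S)" for h S :: real
        using that by simp
      from this[of "sqrt (-k)"] show ?thesis using 3 by (simp add: sn_def)
    qed
    ultimately show ?thesis by simp
  qed
qed

lemma continuous_md: "continuous_on A (md k)"
  by (meson DERIV_md DERIV_continuous continuous_at_imp_continuous_on)

lemma continuous_sn: "continuous_on A (sn k)"
proof -
  consider "k > 0" | "k = 0" | "k < 0" by linarith
  then show ?thesis
    by cases (auto simp: sn_def intro!: continuous_intros)
qed

lemma continuous_cs: "continuous_on A (cs k)"
proof -
  consider "k > 0" | "k = 0" | "k < 0" by linarith
  then show ?thesis
    by cases (auto simp: cs_def intro!: continuous_intros)
qed

lemma md_strict_mono:
  assumes "0 \<le> s" "s < t" "k > 0 \<Longrightarrow> t \<le> pi / sqrt k"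
  shows "md k s < md k t"
proof (rule DERIV_pos_imp_increasing_open[OF assms(2)])
  fix x assume "s < x" "x < t"
  then show "\<exists>y. (md k has_real_derivative y) (at x) \<and> 0 < y"
    using assms by (intro exI[of _ "sn k x"] conjI DERIV_md sn_pos) (auto simp: below_diameter_def)
qed (rule continuous_md)

lemma md_mono:
  assumes "0 \<le> s" "s \<le> t" "k > 0 \<Longrightarrow> t \<le> pi / sqrt k"
  shows "md k s \<le> md k t"
  using md_strict_mono[of s t k] assms by (cases "s = t") auto

lemma md_le_iff:
  assumes "0 \<le> s" "0 \<le> t" "k > 0 \<Longrightarrow> s \<le> pi / sqrt k" "k > 0 \<Longrightarrow> t \<le> pi / sqrt k"
  shows "md k s \<le> md k t \<longleftrightarrow> s \<le> t"
  using md_strict_mono[of t s k] md_mono[of s t k] assms by (meson leD le_less_linear)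

lemma md_inj:
  assumes "0 \<le> s" "0 \<le> t" "k > 0 \<Longrightarrow> s \<le> pi / sqrt k" "k > 0 \<Longrightarrow> t \<le> pi / sqrt k" "md k s = md k t"
  shows "s = t"
  using md_le_iff[of s t k] md_le_iff[of t s k] assms by auto

text \<open>The equality case of \<open>stewart_le\<close> below for a degenerate triangle: a geodesic of length \<open>t + e\<close> is
  prolonged backwards by \<open>a\<close> to a point \<open>p\<close>, whose distances from its start, its inner point and its
  end are \<open>a\<close>, \<open>a + t\<close> and \<open>a + t + e\<close>. Subtracted from \<open>stewart_le\<close> for a general triangle, it leaves a comparison of angles.\<close>

lemma stewart_collinear:
  "sn k (t + e) * md k (a + t) - sn k t * md k (a + t + e)
    = sn k e * (md k a - md k t) - sn k t * md k e"
proof -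
  define A T E where "A = md k a" "T = md k t" "E = md k e"
  define a' t' e' where "a' = sn k a" "t' = sn k t" "e' = sn k e"
  have r: "t'\<^sup>2 = 2 * T - k * T\<^sup>2"
    by (simp add: a'_t'_e'_def A_T_E_def sn_square)
  show ?thesis
    unfolding md_add sn_add cs_add cs_md A_T_E_def[symmetric] a'_t'_e'_def[symmetric]
    using r by algebra
qed

lemma md_diff: "md k (s - t) = md k (s + t) - 2 * (sn k s * sn k t)"
  using md_add[of k s t] md_add[of k s "- t"] by simp

text \<open>Here \<open>a, u, c\<close> are the sides \<open>px\<close>, \<open>xx'\<close>, \<open>px'\<close> of a model triangle with \<open>X = sn a * (1 + cos x)\<close> and
  \<open>X' = sn c * (1 + cos x')\<close>, where \<open>x\<close> and \<open>x'\<close> also denote its angles. Prolong \<open>[xx']\<close> beyond \<open>x'\<close> by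
  \<open>b\<close> to a point \<open>q\<close>. The two sides of the identity are the law of cosines for \<open>|pq|\<close>, seen from \<open>x\<close>
  and from \<open>x'\<close>; the angle at \<open>x'\<close> towards \<open>q\<close> is the supplement of the one towards \<open>x\<close>.\<close>

lemma stewart_hinge:
  assumes u: "sn k u \<noteq> 0"
    and 1: "md k c = md k (a + u) - sn k u * X"
    and 2: "md k a = md k (c + u) - sn k u * X'"
  shows "md k (a + u + b) - sn k (u + b) * X = md k (c + b) - sn k b * (2 * sn k c - X')"
proof -
  define A U B C where d1: "A = md k a" "U = md k u" "B = md k b" "C = md k c"
  define a' u' b' c' where d2: "a' = sn k a" "u' = sn k u" "b' = sn k b" "c' = sn k c"
  have r: "u'\<^sup>2 = 2 * U - k * U\<^sup>2" "u' \<noteq> 0"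
    using u by (auto simp: d1 d2 sn_square)
  have 1: "u' * X = U + (1 - k * U) * A + a' * u' - C"
    using 1 by (simp add: md_add cs_md flip: d1 d2)
  have 2: "u' * X' = U + (1 - k * U) * C + c' * u' - A"
    using 2 by (simp add: md_add cs_md flip: d1 d2)
  have "u' * (md k (a + u + b) - sn k (u + b) * X) = u' * (md k (c + b) - sn k b * (2 * sn k c - X'))"
    unfolding md_add sn_add cs_add cs_md d1[symmetric] d2[symmetric]
    using r(1) 1 2 by algebra
  with r(2) show ?thesis by simp
qed

section \<open>The model planes\<close>

lemma model_dist_bounds:
  assumes "x \<in> model_plane k" "y \<in> model_plane k"
  shows "0 \<le> model_dist k x y" "k > 0 \<Longrightarrow> model_dist k x y \<le> pi / sqrt k"
proof -
  interpret Metric_space "model_plane k" "model_dist k" by (rule Metric_space_model)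
  show "0 \<le> model_dist k x y" by simp
  assume k: "k > 0"
  then have "arccos (k * (x \<bullet> y)) \<le> pi"
    using model_plane_pos_abs_le[OF k assms] by (intro arccos_ubound) (auto simp: abs_le_iff)
  then show "model_dist k x y \<le> pi / sqrt k"
    using k assms by (simp add: model_dist_def divide_right_mono)
qed

text \<open>The inner product for \<open>k > 0\<close> and the Minkowski form for \<open>k < 0\<close>, so that both can be
  treated together. For \<open>k = 0\<close> the distance of two points is not a function of the value of the form on
  them, and that case is separate.\<close>

definition model_form :: "real \<Rightarrow> real^3 \<Rightarrow> real^3 \<Rightarrow> real" where
  "model_form k x y = x$1 * y$1 + x$2 * y$2 + sgn k * (x$3 * y$3)"

lemma model_form_commute: "model_form k x y = model_form k y x"
  by (simp add: model_form_def mult.commute)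

lemma model_form_simps:
  "model_form k (x + y) z = model_form k x z + model_form k y z" "model_form k (x - y) z = model_form k x z - model_form k y z"
  "model_form k (c *\<^sub>R x) z = c * model_form k x z"
  "model_form k z (x + y) = model_form k z x + model_form k z y" "model_form k z (x - y) = model_form k z x - model_form k z y"
  "model_form k z (c *\<^sub>R x) = c * model_form k z x"
  by (simp_all add: model_form_def algebra_simps)

lemma model_form_self:
  assumes "x \<in> model_plane k" "k \<noteq> 0" shows "k * model_form k x x = 1"
  using assms by (auto simp: model_plane_def model_form_def inner_real3 mink_def split: if_splits)

lemma cs_model_dist:
  assumes "x \<in> model_plane k" "y \<in> model_plane k" "k \<noteq> 0"
  shows "cs k (model_dist k x y) = k * model_form k x y"
proof (cases "k > 0")
  case True
  have f: "model_form k x y = x \<bullet> y" using True by (simp add: model_form_def inner_real3)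
  show ?thesis
    using True assms model_plane_pos_abs_le[OF True assms(1,2)]
    by (simp add: cs_def model_dist_def f cos_arccos_abs)
next
  case False
  then have k: "k < 0" using assms by simp
  have f: "model_form k x y = mink x y" using k by (simp add: model_form_def mink_def)
  show ?thesis
    using k assms model_plane_neg_ge_1(1)[OF k assms(1,2)]
    by (simp add: cs_def model_dist_def f)
qed

text \<open>For \<open>k < 0\<close> the form is indefinite, but it is positive definite on the orthogonal complement of a
  point of the hyperboloid.\<close>

lemma model_form_degenerate:
  assumes k: "k \<noteq> 0" and x: "x \<in> model_plane k"
    and vv: "model_form k v v = 0" and vx: "model_form k v x = 0"
  shows "v = 0"
proof (cases "k > 0")
  case True
  then have "v \<bullet> v = 0" using vv by (simp add: model_form_def inner_real3)
  then show ?thesis by simp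
next
  case False
  then have k: "k < 0" using k by simp
  define r where "r = - 1 / k"
  have r: "r > 0" using k by (simp add: r_def field_simps)
  have 1: "(x$3)\<^sup>2 = r + (x$1)\<^sup>2 + (x$2)\<^sup>2"
    using k x by (auto simp: model_plane_def mink_def r_def power2_eq_square)
  have 2: "(v$3)\<^sup>2 = (v$1)\<^sup>2 + (v$2)\<^sup>2" and 3: "v$3 * x$3 = v$1 * x$1 + v$2 * x$2"
    using vv vx k by (auto simp: model_form_def power2_eq_square)
  have "(v$3)\<^sup>2 * r = - ((v$1 * x$2 - v$2 * x$1)\<^sup>2)"
    using 1 2 3 by algebra
  then have "(v$3)\<^sup>2 * r \<le> 0" by simp
  then have "v$3 = 0" using r by (simp add: mult_le_0_iff)
  with 2 have "v$1 = 0" "v$2 = 0" by (simp_all add: sum_power2_eq_zero_iff)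
  with \<open>v$3 = 0\<close> show ?thesis by (simp add: vec_eq_iff forall_3)
qed

text \<open>The points \<open>q, s, r\<close> lie on a geodesic, so that \<open>s\<close> is a linear combination of \<open>q\<close> and \<open>r\<close> with
  coefficients given by \<open>sn\<close>. Pairing this relation with \<open>p\<close> gives the claim.\<close>

lemma stewart_model:
  assumes m: "p \<in> model_plane k" "q \<in> model_plane k" "r \<in> model_plane k" "s \<in> model_plane k"
    and t: "model_dist k q s = t" "model_dist k s r = e" "model_dist k q r = t + e"
  shows "sn k (t + e) * md k (model_dist k p s)
    = sn k e * (md k (model_dist k p q) - md k t) + sn k t * (md k (model_dist k p r) - md k e)"
proof (cases "k = 0")
  case True
  have d: "dist q s = t" "dist s r = e" "dist q r = t + e"
    using t m True by (simp_all add: model_dist_def)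
  define a b w where "a = q - s" "b = s - r" "w = p - s"
  have n: "norm a = t" "norm b = e" using d by (simp_all add: a_b_w_def dist_norm)
  have "norm (q - r) = norm (q - s) + norm (s - r)" using d by (simp add: dist_norm)
  then have ab: "t *\<^sub>R b = e *\<^sub>R a"
    using norm_triangle_eq[of a b] n by (simp add: a_b_w_def)
  have aa: "a \<bullet> a = t\<^sup>2" "b \<bullet> b = e\<^sup>2" using n by (simp_all add: power2_norm_eq_inner flip: n)
  have wab: "t * (w \<bullet> b) = e * (w \<bullet> a)" using arg_cong[OF ab, of "\<lambda>z. w \<bullet> z"] by simp
  have "(dist p q)\<^sup>2 = (w - a) \<bullet> (w - a)" "(dist p r)\<^sup>2 = (w + b) \<bullet> (w + b)" "(dist p s)\<^sup>2 = w \<bullet> w"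
    by (simp_all add: dist_norm power2_norm_eq_inner a_b_w_def)
  then have pq: "(dist p q)\<^sup>2 = w \<bullet> w - 2 * (w \<bullet> a) + t\<^sup>2"
    and pr: "(dist p r)\<^sup>2 = w \<bullet> w + 2 * (w \<bullet> b) + e\<^sup>2" and ps: "(dist p s)\<^sup>2 = w \<bullet> w"
    by (simp_all add: inner_diff inner_add aa inner_commute)
  have "(t + e) * (dist p s)\<^sup>2 = e * ((dist p q)\<^sup>2 - t\<^sup>2) + t * ((dist p r)\<^sup>2 - e\<^sup>2)"
    unfolding pq pr ps using wab by algebra
  then show ?thesis using True m by (simp add: md_def sn_def model_dist_def field_simps)
next
  case k: False
  have f: "k * model_form k q s = cs k t" "k * model_form k s r = cs k e" "k * model_form k q r = cs k (t + e)"
    using cs_model_dist k m t by metis+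
  note f1 = model_form_self[OF m(2) k] model_form_self[OF m(3) k] model_form_self[OF m(4) k]
  \<comment> \<open>The vector \<open>v\<close> is orthogonal to \<open>q\<close>, \<open>r\<close>, \<open>s\<close>, hence to itself, and therefore vanishes.\<close>
  define v where "v = sn k (t + e) *\<^sub>R s - sn k e *\<^sub>R q - sn k t *\<^sub>R r"
  have lin: "k * model_form k z v = sn k (t + e) * (k * model_form k z s) - sn k e * (k * model_form k z q) - sn k t * (k * model_form k z r)" for z
    by (simp add: v_def model_form_simps algebra_simps)
  note sq = sn_square[of k t] sn_square[of k e]
  have "k * model_form k s v = 0"
    unfolding lin f f1 model_form_commute[of k s q] by (simp add: sn_add)
  moreover have qv: "k * model_form k q v = 0"
    unfolding lin f f1 sn_add cs_md md_add using sq by algebra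
  moreover have rv: "k * model_form k r v = 0"
    unfolding lin model_form_commute[of k r s] model_form_commute[of k r q] f f1 sn_add cs_md md_add using sq by algebra
  ultimately have 0: "model_form k s v = 0" "model_form k q v = 0" "model_form k r v = 0" using k by auto
  have "model_form k v v = sn k (t + e) * model_form k s v - sn k e * model_form k q v - sn k t * model_form k r v"
    by (subst v_def) (simp add: model_form_simps)
  with 0 have "v = 0" using model_form_degenerate[OF k m(4)] model_form_commute by simp
  then have "k * model_form k p v = 0" by (simp add: model_form_def)
  then have "sn k (t + e) * cs k (model_dist k p s) = sn k e * cs k (model_dist k p q) + sn k t * cs k (model_dist k p r)"
    unfolding lin using cs_model_dist m k by simp
  moreover have "sn k (t + e) = sn k e * cs k t + sn k t * cs k e"
    by (simp add: sn_add)
  ultimately have "k * (sn k (t + e) * md k (model_dist k p s))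
    = k * (sn k e * (md k (model_dist k p q) - md k t) + sn k t * (md k (model_dist k p r) - md k e))"
    unfolding cs_md by algebra
  with k show ?thesis by simp
qed

text \<open>Geodesic polar coordinates around the north pole (the origin for \<open>k = 0\<close>); the rays \<open>u = const\<close>
  are unit speed geodesics.\<close>

definition polar :: "real \<Rightarrow> real \<Rightarrow> real \<Rightarrow> real^3" where
  "polar k r u = vector [sn k r * cos u, sn k r * sin u, if k = 0 then 0 else cs k r / sqrt \<bar>k\<bar>]"

lemma polar_model_form:
  assumes "k \<noteq> 0"
  shows "k * model_form k (polar k r u) (polar k s v) = cs k (r + s) + k * (sn k r * sn k s * (1 + cos (u - v)))"
proof -
  have "k * (sgn k * (cs k r / sqrt \<bar>k\<bar> * (cs k s / sqrt \<bar>k\<bar>))) = cs k r * cs k s"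
    using assms by (simp add: sgn_if)
  then show ?thesis
    using assms
    by (simp add: model_form_def polar_def vector_def cs_add cos_diff algebra_simps)
qed

lemma polar_in_model: "polar k r u \<in> model_plane k"
proof (cases "k = 0")
  case True
  then show ?thesis by (simp add: model_plane_def polar_def)
next
  case False
  have "k * model_form k (polar k r u) (polar k r u) = 1"
    unfolding polar_model_form[OF False] cs_md md_add diff_self cos_zero
    using sn_square[of k r] by algebra
  then have "model_form k (polar k r u) (polar k r u) = 1 / k" using False by (simp add: field_simps)
  moreover have "polar k r u $ 3 > 0" if "k < 0" using that by (simp add: cs_def polar_def)
  moreover have "x \<in> model_plane k" if "model_form k x x = 1 / k" "k < 0 \<Longrightarrow> x $ 3 > 0" for x
    using that False by (auto simp: model_plane_def model_form_def inner_real3 mink_def)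
  ultimately show ?thesis by blast
qed

lemma model_dist_polar:
  assumes "0 \<le> d" "k > 0 \<Longrightarrow> d \<le> pi / sqrt k"
    and "md k d = md k (r + s) - sn k r * sn k s * (1 + cos (u - v))"
  shows "model_dist k (polar k r u) (polar k s v) = d"
proof (rule md_inj[of _ _ k])
  let ?x = "polar k r u" and ?y = "polar k s v"
  show "md k (model_dist k ?x ?y) = md k d"
  proof (cases "k = 0")
    case False
    then have "cs k (model_dist k ?x ?y) = cs k (r + s) + k * (sn k r * sn k s * (1 + cos (u - v)))"
      by (simp add: cs_model_dist polar_in_model polar_model_form)
    also have "\<dots> = cs k d"
      unfolding cs_md assms(3) by (simp add: algebra_simps)
    finally have "cs k (model_dist k ?x ?y) = cs k d" .
    with False show ?thesis by (simp add: md_def)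
  next
    case True
    have "(dist ?x ?y)\<^sup>2 = (r * cos u - s * cos v)\<^sup>2 + (r * sin u - s * sin v)\<^sup>2"
      unfolding dist_norm power2_norm_eq_inner
      using True by (simp add: inner_real3 polar_def sn_def power2_eq_square)
    also have "\<dots> = r\<^sup>2 + s\<^sup>2 - 2 * r * s * cos (u - v)"
      unfolding cos_diff using sin_cos_squared_add[of u] sin_cos_squared_add[of v] by algebra
    also have "\<dots> = d\<^sup>2"
      using assms(3) True by (simp add: md_def sn_def power2_eq_square field_simps)
    finally show ?thesis using True polar_in_model[of k] by (simp add: md_def model_dist_def)
  qed
qed (use assms model_dist_bounds polar_in_model in auto)

text \<open>Every triple of lengths that satisfies the triangle inequalities comes from an angle between
  the sides of length \<open>a\<close> and \<open>b\<close>: the extreme values \<open>x = -1\<close> and \<open>x = 1\<close> correspond to the third side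
  \<open>a + b\<close> and \<open>\<bar>a - b\<bar>\<close>.\<close>

lemma hinge_cosine_exists:
  assumes "0 \<le> a" "0 \<le> b" "below_diameter k (a + b)" "c \<le> a + b" "\<bar>a - b\<bar> \<le> c"
  obtains x where "\<bar>x\<bar> \<le> 1" "md k c = md k (a + b) - sn k a * sn k b * (1 + x)"
proof (cases "a = 0 \<or> b = 0")
  case True
  then have "c = a + b" using assms by auto
  then show ?thesis using that[of "- 1"] by simp
next
  case False
  then have ab: "a > 0" "b > 0" using assms by auto
  define N where "N = sn k a * sn k b"
  have N: "N > 0" unfolding N_def
    using ab assms by (intro mult_pos_pos sn_pos) (auto elim: below_diameter_mono)
  define x where "x = (md k (a + b) - md k c) / N - 1"
  have "md k c \<le> md k (a + b)" "md k \<bar>a - b\<bar> \<le> md k c"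
    using md_mono[of c "a + b" k] md_mono[of "\<bar>a - b\<bar>" c k] assms by (auto simp: below_diameter_def)
  moreover have "md k (a - b) = md k (a + b) - 2 * N"
    using md_diff[of k a b] by (simp add: N_def)
  ultimately have "0 \<le> x + 1" "x + 1 \<le> 2"
    using N by (auto simp: x_def field_simps)
  moreover have "md k c = md k (a + b) - N * (1 + x)" using N by (simp add: x_def)
  ultimately show ?thesis using that[of x] unfolding N_def by force
qed

section \<open>Shortest paths and unit speed geodesics\<close>

lemma curve_length_ge:
  assumes "mono_on {..n} t" "t ` {..n} \<subseteq> {0..1}"
  shows "ereal (\<Sum>i<n. d (g (t i)) (g (t (Suc i)))) \<le> curve_length d g"
  unfolding curve_length_def using assms
  by (intro SUP_upper2[where i = "(n, t)"]) auto

lemma curve_length_ge_three: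
  assumes "0 \<le> s" "s \<le> t" "t \<le> (1::real)"
  shows "ereal (d (g 0) (g s) + d (g s) (g t) + d (g t) (g 1)) \<le> curve_length d g"
proof -
  define h :: "nat \<Rightarrow> real" where "h i = (if i = 0 then 0 else if i = 1 then s else if i = 2 then t else 1)" for i
  have "mono_on {..3} h" using assms by (auto simp: mono_on_def h_def)
  moreover have "h ` {..3} \<subseteq> {0..1}" using assms by (auto simp: h_def)
  ultimately show ?thesis
    using curve_length_ge[of 3 h d g] by (simp add: numeral_3_eq_3 h_def)
qed

lemma (in Metric_space) min_geodesic_between:
  assumes "min_geodesic M d q r S" "s \<in> S"
  shows "q \<in> M" "r \<in> M" "s \<in> M" "d q s + d s r = d q r"
proof -
  obtain g where g: "g \<in> curves_between M d q r" "curve_length d g = ereal (d q r)" "S = g ` {0..1}"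
    using assms(1) by (auto simp: min_geodesic_def)
  then obtain u where u: "u \<in> {0..1}" "s = g u" using assms by auto
  have "g \<in> {0..1} \<rightarrow> M" "g 0 = q" "g 1 = r"
    using g(1) continuous_map_image_subset_topspace[of "top_of_set {0..1}" mtopology g]
    by (auto simp: curves_between_def pathin_def)
  then show m: "q \<in> M" "r \<in> M" "s \<in> M" using u by auto
  have "d q s + d s s + d s r \<le> d q r"
    using curve_length_ge_three[of u u d g] u g(2) \<open>g 0 = q\<close> \<open>g 1 = r\<close> by simp
  then show "d q s + d s r = d q r" using triangle[of q s r] m by simp
qed

lemma (in Metric_space) unit_speed_min_geodesic:
  assumes M: "\<And>t. t \<in> {0..l} \<Longrightarrow> c t \<in> M" and l: "0 \<le> l"
    and d: "\<And>s t. s \<in> {0..l} \<Longrightarrow> t \<in> {0..l} \<Longrightarrow> d (c s) (c t) = \<bar>s - t\<bar>"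
  shows "min_geodesic M d (c 0) (c l) (c ` {0..l})"
proof -
  define g where "g t = c (l * t)" for t
  have in01: "l * t \<in> {0..l}" if "t \<in> {0..1}" for t
    using that l by (auto simp: mult_left_le)
  have dg: "d (g s) (g t) = l * \<bar>s - t\<bar>" if "s \<in> {0..1}" "t \<in> {0..1}" for s t
    unfolding g_def using that l in01[of s] in01[of t] 
    by (simp add: d abs_mult flip: right_diff_distrib)
  have "continuous_map (top_of_set {0..1}) mtopology g"
    unfolding continuous_map_to_metric
  proof (intro ballI allI impI)
    fix x \<epsilon> :: real assume x: "x \<in> topspace (top_of_set {0..1})" and e: "0 < \<epsilon>"
    let ?U = "{0..1} \<inter> ball x (\<epsilon> / (l + 1))"
    have "l * \<bar>x - y\<bar> < \<epsilon>" if "dist x y < \<epsilon> / (l + 1)" for y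
    proof -
      have "(l + 1) * \<bar>x - y\<bar> < \<epsilon>" using that l by (simp add: dist_real_def field_simps)
      then show ?thesis by (simp add: distrib_right)
    qed
    then show "\<exists>U. openin (top_of_set {0..1}) U \<and> x \<in> U \<and> (\<forall>y\<in>U. g y \<in> mball (g x) \<epsilon>)"
      using x e l dg in01 M
      by (intro exI[of _ ?U]) (auto simp: openin_open_Int g_def)
  qed
  then have 1: "g \<in> curves_between M d (c 0) (c l)"
    by (simp add: curves_between_def pathin_def g_def)
  have le: "(\<Sum>i<n. d (g (t i)) (g (t (Suc i)))) \<le> l" if t: "mono_on {..n} t" "t ` {..n} \<subseteq> {0..1}" for n t
  proof -
    have t01: "t j \<in> {0..1}" if "j \<le> n" for j using t(2) that by blast
    have "(\<Sum>i<n. d (g (t i)) (g (t (Suc i)))) = (\<Sum>i<n. l * t (Suc i) - l * t i)"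
    proof (rule sum.cong)
      fix i assume i: "i \<in> {..<n}"
      then have "t i \<le> t (Suc i)" using t(1) by (auto simp: mono_on_def)
      moreover have "t i \<in> {0..1}" "t (Suc i) \<in> {0..1}"
        using i t01[of i] t01[of "Suc i"] by auto
      ultimately show "d (g (t i)) (g (t (Suc i))) = l * t (Suc i) - l * t i"
        by (simp add: dg algebra_simps)
    qed simp
    also have "\<dots> = l * (t n - t 0)"
      by (subst sum_lessThan_telescope) (simp add: algebra_simps)
    also have "\<dots> \<le> l * 1"
    proof (intro mult_left_mono)
      have "t n \<in> {0..1}" "t 0 \<in> {0..1}" using t(2) by auto
      then show "t n - t 0 \<le> 1" by auto
    qed (use l in auto)
    finally show ?thesis by simp
  qed
  have "curve_length d g \<le> ereal l"
    unfolding curve_length_def by (intro SUP_least) (use le in auto)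
  moreover have "ereal l \<le> curve_length d g"
    using curve_length_ge_three[of 0 0 d g] dg l by simp
  moreover have "d (c 0) (c l) = l" using d[of 0 l] l by simp
  moreover have "c ` {0..l} = g ` {0..1}"
  proof (cases "l = 0")
    case False
    have "(\<lambda>t. l * t) ` {0..1} = {0..l}"
      using l False by (subst image_mult_atLeastAtMost) auto
    then show ?thesis unfolding g_def by (metis image_image)
  next
    case True
    have "(0::real) \<in> {0..1}" by simp
    then show ?thesis using True by (auto simp: g_def intro!: image_eqI)
  qed
  ultimately show ?thesis using 1 unfolding min_geodesic_def by (metis antisym)
qed

definition unit_speed :: "(real \<Rightarrow> 'a::metric_space) \<Rightarrow> real \<Rightarrow> bool" where
  "unit_speed c l \<longleftrightarrow> 0 \<le> l \<and> (\<forall>s\<in>{0..l}. \<forall>t\<in>{0..l}. dist (c s) (c t) = \<bar>s - t\<bar>)"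

lemma unit_speed_dist: "unit_speed c l \<Longrightarrow> 0 \<le> s \<Longrightarrow> s \<le> l \<Longrightarrow> 0 \<le> t \<Longrightarrow> t \<le> l \<Longrightarrow> dist (c s) (c t) = \<bar>s - t\<bar>"
  by (auto simp: unit_speed_def)

lemma unit_speed_imp_min_geodesic: "unit_speed c l \<Longrightarrow> min_geodesic UNIV dist (c 0) (c l) (c ` {0..l})"
  by (rule Met_TC.unit_speed_min_geodesic) (auto simp: unit_speed_def)

text \<open>On a shortest path from \<open>q\<close> the distance to \<open>q\<close> is itself an arc length parameter: no part of the
  triangle inequality is lost along the curve. A point of the path at distance \<open>u\<close> from \<open>q\<close> exists by
  the intermediate value theorem.\<close>

lemma min_geodesic_imp_unit_speed:
  assumes "min_geodesic UNIV dist q r S"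
  obtains c where "unit_speed c (dist q r)" "c 0 = q" "c (dist q r) = r" "S = c ` {0..dist q r}"
proof -
  let ?l = "dist q r"
  obtain g where g: "g \<in> curves_between UNIV dist q r" "curve_length dist g = ereal ?l" "S = g ` {0..1}"
    using assms by (auto simp: min_geodesic_def)
  have g01: "g 0 = q" "g 1 = r" and cont: "continuous_on {0..1} g"
    using g(1) by (auto simp: curves_between_def pathin_def)
  have add: "dist q (g s) + dist (g s) (g t) + dist (g t) r \<le> ?l" if "0 \<le> s" "s \<le> t" "t \<le> 1" for s t
    using curve_length_ge_three[of s t dist g] that g(2) g01 by simp
  have le: "dist (g s) (g t) = \<bar>dist q (g s) - dist q (g t)\<bar>" if "0 \<le> s" "s \<le> t" "t \<le> 1" for s t
    using add[OF that] dist_triangle[of q r "g t"] dist_triangle[of q "g t" "g s"] zero_le_dist[of "g s" "g t"] by linarith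
  have dd: "dist (g s) (g t) = \<bar>dist q (g s) - dist q (g t)\<bar>" if "s \<in> {0..1}" "t \<in> {0..1}" for s t
    using le[of s t] le[of t s] that by (cases "s \<le> t") (auto simp: dist_commute[of "g s" "g t"] abs_minus_commute)
  have "\<exists>t. t \<in> {0..1} \<and> dist q (g t) = u" if "u \<in> {0..?l}" for u
  proof -
    have "continuous_on {0..1} (\<lambda>t. dist q (g t))" using cont by (intro continuous_intros)
    with IVT'[of "\<lambda>t. dist q (g t)" 0 u 1] that g01 show ?thesis by auto
  qed
  then obtain t where t: "\<And>u. u \<in> {0..?l} \<Longrightarrow> t u \<in> {0..1} \<and> dist q (g (t u)) = u" by metis
  have eq: "g (t (dist q x)) = x" "dist q x \<in> {0..?l}" if x: "x \<in> S" for x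
  proof -
    obtain v where v: "v \<in> {0..1}" "x = g v" using x g(3) by auto
    then show *: "dist q x \<in> {0..?l}" using add[of v v] by auto (smt (verit) zero_le_dist)
    have "dist (g (t (dist q x))) (g v) = 0" using dd[of "t (dist q x)" v] t[OF *] v by simp
    then show "g (t (dist q x)) = x" using v by simp
  qed
  have qr: "q \<in> S" "r \<in> S" using g(3) g01 by (metis atLeastAtMost_iff image_eqI order_refl zero_le_one)+
  show ?thesis
  proof (rule that[of "\<lambda>u. g (t u)"])
    show "unit_speed (\<lambda>u. g (t u)) ?l" using dd t by (auto simp: unit_speed_def)
    show "g (t 0) = q" using eq(1)[OF qr(1)] by simp
    show "g (t ?l) = r" using eq(1)[OF qr(2)] by simp
    show "S = (\<lambda>u. g (t u)) ` {0..?l}"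
    proof
      show "S \<subseteq> (\<lambda>u. g (t u)) ` {0..?l}"
      proof
        fix x assume "x \<in> S"
        from eq[OF this] show "x \<in> (\<lambda>u. g (t u)) ` {0..?l}"
          by (intro image_eqI[of _ _ "dist q x"]) auto
      qed
      show "(\<lambda>u. g (t u)) ` {0..?l} \<subseteq> S" using t g(3) by blast
    qed
  qed
qed

section \<open>The theorem of Hopf and Rinow\<close>

lemma length_space_almost_between:
  fixes x y :: "'a::metric_space"
  assumes "length_space (UNIV :: 'a set) dist" "0 \<le> t" "t \<le> dist x y" "0 < e"
  shows "\<exists>z. dist x z = t \<and> dist z y < dist x y - t + e"
proof -
  have "(INF g \<in> curves_between UNIV dist x y. curve_length dist g) = ereal (dist x y)"
    using assms(1) by (simp add: length_space_def)
  also have "\<dots> < ereal (dist x y + e)" using assms(4) by simp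
  finally obtain g where g: "g \<in> curves_between UNIV dist x y" "curve_length dist g < ereal (dist x y + e)"
    by (auto simp: INF_less_iff)
  have g01: "g 0 = x" "g 1 = y" and cont: "continuous_on {0..1} g"
    using g(1) by (auto simp: curves_between_def pathin_def)
  have "continuous_on {0..1} (\<lambda>u. dist x (g u))" using cont by (intro continuous_intros)
  with IVT'[of "\<lambda>u. dist x (g u)" 0 t 1] assms g01
  obtain u where u: "0 \<le> u" "u \<le> 1" "dist x (g u) = t" by auto
  have "ereal (dist x (g u) + dist (g u) (g u) + dist (g u) y) < ereal (dist x y + e)"
    using le_less_trans[OF curve_length_ge_three[of u u dist g] g(2)] u g01 by simp
  then show ?thesis using u by (intro exI[of _ "g u"]) simp
qed

text \<open>In a locally compact space a compact set has a uniform neighbourhood with compact closure.\<close>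

lemma compact_thickening:
  fixes K :: "'a::metric_space set"
  assumes K: "compact K" and loc: "\<And>x. x \<in> K \<Longrightarrow> \<exists>r>0. compact (cball x r)"
  shows "\<exists>\<delta>>0. \<forall>A. closed A \<longrightarrow> A \<subseteq> (\<Union>x\<in>K. cball x \<delta>) \<longrightarrow> compact A"
proof -
  from loc obtain r where r: "\<And>x. x \<in> K \<Longrightarrow> r x > 0 \<and> compact (cball x (r x))" by metis
  have "K \<subseteq> (\<Union>x\<in>K. ball x (r x / 2))" using r by force
  from compactE_image[OF K, of K, OF _ this]
  obtain F where F: "F \<subseteq> K" "finite F" "K \<subseteq> (\<Union>x\<in>F. ball x (r x / 2))" by auto
  define \<delta> where "\<delta> = Min (insert 1 ((\<lambda>x. r x / 2) ` F))"
  have \<delta>: "\<delta> > 0" using F r by (auto simp: \<delta>_def)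
  have \<delta>le: "\<delta> \<le> r x / 2" if "x \<in> F" for x
    unfolding \<delta>_def using F that by (intro Min_le) auto
  have "compact A" if A: "closed A" "A \<subseteq> (\<Union>x\<in>K. cball x \<delta>)" for A
  proof -
    have "A \<subseteq> (\<Union>x\<in>F. cball x (r x))"
    proof
      fix a assume "a \<in> A"
      then obtain x where x: "x \<in> K" "dist x a \<le> \<delta>" using A by auto
      then obtain z where z: "z \<in> F" "dist z x < r z / 2" using F by auto
      have "dist z a \<le> r z" using dist_triangle[of z a x] x z \<delta>le[OF z(1)] by linarith
      with z show "a \<in> (\<Union>x\<in>F. cball x (r x))" by auto
    qed
    moreover have "compact (\<Union>x\<in>F. cball x (r x))" using F r by (intro compact_UN) auto
    ultimately show ?thesis using A(1) by (metis compact_Int_closed inf.absorb_iff2)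
  qed
  with \<delta> show ?thesis by blast
qed

text \<open>The set of radii with compact ball is open, because slightly larger balls stay in a thickening of a
  compact one, and closed, because a ball whose smaller concentric balls are compact is totally
  bounded. Almost shortest curves provide the points on slightly smaller spheres.\<close>

lemma hopf_rinow_proper:
  fixes a :: "'a::metric_space"
  assumes "complete (UNIV :: 'a set)" and ls: "length_space (UNIV :: 'a set) dist"
    and lc: "locally_compact_space (Metric_space.mtopology (UNIV :: 'a set) dist)"
  shows "compact (cball a R)"
proof -
  have loc: "\<exists>r>0. compact (cball x r)" for x :: 'a
  proof -
    obtain U K where "open U" "compact K" "x \<in> U" "U \<subseteq> K"
      using lc[unfolded locally_compact_space_def mtopology_is_euclidean topspace_euclidean, rule_format, of x]
      by auto
    then obtain r where "r > 0" "cball x r \<subseteq> K" by (metis open_contains_cball subset_trans)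
    then show ?thesis using \<open>compact K\<close> by (metis closed_cball compact_Int_closed inf.absorb_iff2)
  qed
  define G where "G = {R. R \<ge> 0 \<and> compact (cball a R)}"
  have sub: "cball a R' \<subseteq> (\<Union>x\<in>cball a R. cball x \<delta>)" if R: "0 \<le> R" "0 < \<delta>" "R' \<le> R + \<delta> / 2" for R R' \<delta>
  proof
    fix y assume y: "y \<in> cball a R'"
    show "y \<in> (\<Union>x\<in>cball a R. cball x \<delta>)"
    proof (cases "dist a y \<le> R")
      case True then show ?thesis using that by force
    next
      case False
      obtain z where "dist a z = R" "dist z y < dist a y - R + \<delta> / 2"
        using length_space_almost_between[OF ls, of R a y "\<delta>/2"] False R by auto
      then show ?thesis using y R by force
    qed
  qed
  have down: "compact (cball a R')" if "compact (cball a R)" "R' \<le> R" for R R'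
    using that by (metis closed_cball compact_Int_closed inf.absorb_iff2 subset_cball)
  have open_step: "\<exists>\<delta>>0. compact (cball a (R + \<delta>))" if "compact (cball a R)" "0 \<le> R" for R
  proof -
    from compact_thickening[OF that(1) loc] obtain \<delta> where
      d: "\<delta> > 0" "\<And>A. closed A \<Longrightarrow> A \<subseteq> (\<Union>x\<in>cball a R. cball x \<delta>) \<Longrightarrow> compact A" by blast
    have "compact (cball a (R + \<delta> / 2))"
      by (intro d sub closed_cball) (use d that in auto)
    then show ?thesis using d(1) by (meson half_gt_zero)
  qed
  have closed_step: "compact (cball a R)" if R: "R > 0" "\<And>R'. 0 \<le> R' \<Longrightarrow> R' < R \<Longrightarrow> compact (cball a R')" for R
    unfolding compact_eq_totally_bounded
  proof (intro conjI allI impI)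
    show "complete (cball a R)" using assms(1) by (meson closed_cball complete_Int_closed complete_closed_subset subset_UNIV)
    fix e :: real assume e: "e > 0"
    define s where "s = max 0 (R - e / 4)"
    have "compact (cball a s)" using R e by (auto simp: s_def)
    then obtain F where F: "finite F" "cball a s \<subseteq> (\<Union>x\<in>F. ball x (e / 2))"
      using e unfolding compact_eq_totally_bounded by (meson half_gt_zero)
    have "cball a R \<subseteq> (\<Union>x\<in>F. ball x e)"
    proof
      fix y assume "y \<in> cball a R"
      moreover have "0 \<le> s" "R \<le> s + e / 2 / 2" by (auto simp: s_def)
      ultimately have "y \<in> (\<Union>x\<in>cball a s. cball x (e / 2))"
        using sub[of s "e / 2" R] e by (meson half_gt_zero subsetD)
      then obtain z where z: "z \<in> cball a s" "dist z y \<le> e / 2" by auto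
      then obtain x where "x \<in> F" "dist x z < e / 2" using F by auto
      with z have "dist x y < e" using dist_triangle[of x y z] by linarith
      with \<open>x \<in> F\<close> show "y \<in> (\<Union>x\<in>F. ball x e)" by auto
    qed
    with F show "\<exists>k. finite k \<and> cball a R \<subseteq> (\<Union>x\<in>k. ball x e)" by blast
  qed
  have "\<not> bdd_above G"
  proof
    assume bdd: "bdd_above G"
    obtain r where "r > 0" "compact (cball a r)" using loc by blast
    then have r: "r \<in> G" by (simp add: G_def)
    define S where "S = Sup G"
    have "r \<le> S" using r bdd by (simp add: S_def cSup_upper)
    have "compact (cball a R')" if R': "R' < S" for R'
    proof -
      obtain w where "w \<in> G" "R' < w" using less_cSupD[of G R'] R' r by (auto simp: S_def)
      then show ?thesis using down[of w R'] by (simp add: G_def)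
    qed
    then have "compact (cball a S)" using closed_step[of S] \<open>r \<le> S\<close> \<open>r > 0\<close> by auto
    then obtain \<delta> where "\<delta> > 0" "compact (cball a (S + \<delta>))"
      using open_step \<open>r \<le> S\<close> \<open>r > 0\<close> by force
    then have "S + \<delta> \<in> G" using \<open>r \<le> S\<close> \<open>r > 0\<close> by (auto simp: G_def)
    then have "S + \<delta> \<le> S" using bdd unfolding S_def by (rule cSup_upper)
    with \<open>\<delta> > 0\<close> show False by simp
  qed
  then obtain R' where "R' \<in> G" "R < R'" unfolding bdd_above_def by (meson not_le)
  then show ?thesis using down by (auto simp: G_def)
qed

lemma midpoint_exists:
  fixes x y :: "'a::metric_space"
  assumes ls: "length_space (UNIV :: 'a set) dist" and proper: "\<And>(a::'a) R. compact (cball a R)"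
  obtains z where "dist x z = dist x y / 2" "dist z y = dist x y / 2"
proof -
  let ?h = "dist x y / 2"
  have "compact (cball x ?h)" by (rule proper)
  moreover have "continuous_on (cball x ?h) (\<lambda>z. dist z y)" by (intro continuous_intros)
  ultimately obtain z where z: "z \<in> cball x ?h" "\<And>w. w \<in> cball x ?h \<Longrightarrow> dist z y \<le> dist w y"
    using continuous_attains_inf[of "cball x ?h" "\<lambda>z. dist z y"] by fastforce
  have "dist z y \<le> ?h + e" if e: "e > 0" for e
  proof -
    obtain w where "dist x w = ?h" "dist w y < dist x y - ?h + e"
      using length_space_almost_between[OF ls, of ?h x y e] e by auto
    then show ?thesis using z(2)[of w] by auto
  qed
  then have "dist z y \<le> ?h" by (rule field_le_epsilon)
  then show ?thesis using that[of z] z(1) dist_triangle[of x y z] by auto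
qed

text \<open>A set containing \<open>x\<close> and \<open>y\<close> on which the distance from \<open>x\<close> is an isometry into the line is
  enlarged to a maximal one by the lemma of Zorn. It is closed, and a gap in its image could be
  filled by a midpoint of the two points that bound the gap, so its image is the whole interval.\<close>

lemma geodesic_exists:
  fixes x y :: "'a::metric_space"
  assumes comp: "complete (UNIV :: 'a set)"
    and mid: "\<And>x y :: 'a. \<exists>z. dist x z = dist x y / 2 \<and> dist z y = dist x y / 2"
  obtains c where "unit_speed c (dist x y)" "c 0 = x" "c (dist x y) = y"
proof -
  let ?l = "dist x y"
  define aligned where "aligned A \<longleftrightarrow> (\<forall>u\<in>A. \<forall>v\<in>A. dist u v = \<bar>dist x u - dist x v\<bar>)" for A
  define \<A> where "\<A> = {A. x \<in> A \<and> y \<in> A \<and> aligned A \<and> (\<forall>u\<in>A. dist x u \<le> ?l)}"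
  have "{x, y} \<in> \<A>" by (auto simp: \<A>_def aligned_def dist_commute)
  moreover have "\<Union>C \<in> \<A>" if C: "C \<noteq> {}" "subset.chain \<A> C" for C
  proof -
    have sub: "C \<subseteq> \<A>" using C by (simp add: subset.chain_def)
    have "aligned (\<Union>C)" unfolding aligned_def
    proof (intro ballI)
      fix u v assume "u \<in> \<Union>C" "v \<in> \<Union>C"
      then obtain A B where AB: "A \<in> C" "u \<in> A" "B \<in> C" "v \<in> B" by auto
      then have "A \<subseteq> B \<or> B \<subseteq> A" using C(2) by (meson subset_chain_def)
      then obtain D where "D \<in> C" "u \<in> D" "v \<in> D" using AB by blast
      then show "dist u v = \<bar>dist x u - dist x v\<bar>" using sub unfolding \<A>_def aligned_def by blast
    qed
    then show ?thesis using sub C(1) unfolding \<A>_def by blast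
  qed
  ultimately obtain A where A: "A \<in> \<A>" and max: "\<And>B. B \<in> \<A> \<Longrightarrow> A \<subseteq> B \<Longrightarrow> B = A"
    using subset_Zorn_nonempty[of \<A>] by (metis empty_iff)
  have xy: "x \<in> A" "y \<in> A" and al: "\<And>u v. u \<in> A \<Longrightarrow> v \<in> A \<Longrightarrow> dist u v = \<bar>dist x u - dist x v\<bar>"
    and le: "\<And>u. u \<in> A \<Longrightarrow> dist x u \<le> ?l"
    using A unfolding \<A>_def aligned_def by blast+
  have ext: "z \<in> A" if z: "\<And>w. w \<in> A \<Longrightarrow> dist z w = \<bar>dist x z - dist x w\<bar>" "dist x z \<le> ?l" for z
  proof -
    have z': "dist w z = \<bar>dist x w - dist x z\<bar>" if "w \<in> A" for w
      using z(1)[OF that] by (simp add: dist_commute abs_minus_commute)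
    have "aligned (insert z A)"
      unfolding aligned_def
    proof (intro ballI)
      fix u v assume "u \<in> insert z A" "v \<in> insert z A"
      then consider "u = z" "v = z" | "u = z" "v \<in> A" | "u \<in> A" "v = z" | "u \<in> A" "v \<in> A" by blast
      then show "dist u v = \<bar>dist x u - dist x v\<bar>"
      proof cases
        case 2 show ?thesis unfolding 2(1) by (rule z(1)[OF 2(2)])
      next
        case 3 show ?thesis unfolding 3(2) by (rule z'[OF 3(1)])
      qed (simp, rule al)
    qed
    moreover have "\<forall>u\<in>insert z A. dist x u \<le> ?l" using le z(2) by blast
    ultimately have "insert z A \<in> \<A>" using xy by (simp add: \<A>_def)
    then show ?thesis using max[of "insert z A"] by auto
  qed
  have "closed A"
    unfolding closed_sequential_limits
  proof (intro allI impI, elim conjE)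
    fix f z assume f: "\<forall>n. f n \<in> A" "f \<longlonglongrightarrow> z"
    show "z \<in> A"
    proof (rule ext)
      fix w assume w: "w \<in> A"
      have "(\<lambda>n. dist (f n) w) \<longlonglongrightarrow> dist z w" "(\<lambda>n. \<bar>dist x (f n) - dist x w\<bar>) \<longlonglongrightarrow> \<bar>dist x z - dist x w\<bar>"
        using f(2) by (auto intro!: tendsto_intros)
      moreover have "dist (f n) w = \<bar>dist x (f n) - dist x w\<bar>" for n using al f(1) w by auto
      ultimately show "dist z w = \<bar>dist x z - dist x w\<bar>" using LIMSEQ_unique by force
    next
      have "(\<lambda>n. dist x (f n)) \<longlonglongrightarrow> dist x z" using f(2) by (auto intro!: tendsto_intros)
      then show "dist x z \<le> ?l" using f(1) le by (intro LIMSEQ_le_const2) auto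
    qed
  qed
  define T where "T = dist x ` A"
  have Tcl: "closed T"
    unfolding closed_sequential_limits
  proof (intro allI impI, elim conjE)
    fix f t assume f: "\<forall>n. f n \<in> T" "f \<longlonglongrightarrow> t"
    then obtain g where g: "\<And>n. g n \<in> A \<and> f n = dist x (g n)" unfolding T_def image_iff by metis
    have dg: "dist (g m) (g n) = dist (f m) (f n)" for m n using g al by (auto simp: dist_real_def)
    have "Cauchy f" using f(2) by (rule LIMSEQ_imp_Cauchy)
    then have "Cauchy g" by (simp add: Cauchy_def dg)
    then obtain z where z: "g \<longlonglongrightarrow> z" using comp unfolding complete_def by blast
    then have "z \<in> A" using \<open>closed A\<close> g unfolding closed_sequential_limits by blast
    have "(\<lambda>n. dist x (g n)) \<longlonglongrightarrow> dist x z" using z by (auto intro!: tendsto_intros)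
    moreover have "(\<lambda>n. dist x (g n)) \<longlonglongrightarrow> t" using f(2) by (simp flip: g[THEN conjunct2])
    ultimately have "t = dist x z" using LIMSEQ_unique by blast
    then show "t \<in> T" using \<open>z \<in> A\<close> by (simp add: T_def)
  qed
  have T0: "0 \<in> T" "?l \<in> T" using xy by (force simp: T_def)+
  have "t \<in> T" if t: "t \<in> {0..?l}" for t
  proof (rule ccontr)
    assume "t \<notin> T"
    define s where "s = Sup (T \<inter> {0..t})"
    define e where "e = Inf (T \<inter> {t..?l})"
    have c1: "compact (T \<inter> {0..t})" "T \<inter> {0..t} \<noteq> {}" using Tcl T0 t by (auto simp: closed_Int_compact)
    have c2: "compact (T \<inter> {t..?l})" "T \<inter> {t..?l} \<noteq> {}" using Tcl T0 t by (auto simp: closed_Int_compact)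
    have s: "s \<in> T \<inter> {0..t}" unfolding s_def
      using c1 by (intro closed_contains_Sup compact_imp_closed bounded_imp_bdd_above compact_imp_bounded)
    have e: "e \<in> T \<inter> {t..?l}" unfolding e_def
      using c2 by (intro closed_contains_Inf compact_imp_closed bounded_imp_bdd_below compact_imp_bounded)
    have gap: "w \<le> s \<or> e \<le> w" if "w \<in> T" "0 \<le> w" "w \<le> ?l" for w
    proof (cases "w \<le> t")
      case True
      then show ?thesis using that c1 by (auto simp: s_def intro!: cSup_upper bounded_imp_bdd_above compact_imp_bounded)
    next
      case False
      then show ?thesis using that c2 by (auto simp: e_def intro!: cInf_lower bounded_imp_bdd_below compact_imp_bounded)
    qed
    have "s < t" "t < e" using s e \<open>t \<notin> T\<close> by (metis Int_iff atLeastAtMost_iff order_le_less)+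
    obtain u v where u: "u \<in> A" "dist x u = s" and v: "v \<in> A" "dist x v = e"
      using s e by (auto simp: T_def)
    obtain z where z: "dist u z = dist u v / 2" "dist z v = dist u v / 2" using mid by blast
    have uv: "dist u v = e - s" using al[OF u(1) v(1)] u v \<open>s < t\<close> \<open>t < e\<close> by simp
    define m where "m = (e - s) / 2"
    have m: "e = s + 2 * m" by (simp add: m_def field_simps)
    have zm: "dist u z = m" "dist z v = m" using z uv by (simp_all add: m_def)
    have xz: "dist x z = s + m"
      using dist_triangle[of x z u] dist_triangle[of x v z] zm m u v by linarith
    have "z \<in> A"
    proof (rule ext)
      fix w assume w: "w \<in> A"
      have d: "dist w u = \<bar>dist x w - s\<bar>" "dist w v = \<bar>dist x w - e\<bar>" using al w u v by auto
      have "dist x w \<le> s \<or> e \<le> dist x w" using gap[of "dist x w"] w le by (auto simp: T_def)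
      then show "dist z w = \<bar>dist x z - dist x w\<bar>"
      proof
        assume "dist x w \<le> s"
        then have "dist w u = s - dist x w" using d by simp
        then show ?thesis
          using dist_triangle[of z w u] dist_triangle[of x z w] zm xz
            dist_commute[of w u] dist_commute[of z u] dist_commute[of w z] zero_le_dist[of z w] by linarith
      next
        assume "e \<le> dist x w"
        then have "dist w v = dist x w - e" using d by simp
        then show ?thesis
          using dist_triangle[of z w v] dist_triangle[of x w z] zm xz m
            dist_commute[of w v] zero_le_dist[of z w] by linarith
      qed
    next
      show "dist x z \<le> ?l" using xz m e \<open>s < t\<close> \<open>t < e\<close> by simp
    qed
    then have "s + m \<in> T" using xz by (force simp: T_def)
    then show False using gap[of "s + m"] m s e \<open>s < t\<close> \<open>t < e\<close> by simp
  qed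
  then obtain c where c: "\<And>t. t \<in> {0..?l} \<Longrightarrow> c t \<in> A \<and> dist x (c t) = t"
    unfolding T_def image_iff by metis
  show ?thesis
  proof (rule that[of c])
    show "unit_speed c ?l" using c al by (simp add: unit_speed_def)
    show "c 0 = x" using c[of 0] by simp
    show "c ?l = y" using c[of ?l] al[of "c ?l" y] xy by simp
  qed
qed

section \<open>Local comparison\<close>

text \<open>By \<open>stewart_model\<close> equality holds in the model plane. So the inequality is the comparison of
  \<open>|p c(t)|\<close> with the corresponding distance in the triangle of the model plane with sides \<open>|p c(0)|\<close>,
  \<open>|p c(t + e)|\<close> and \<open>t + e\<close>.\<close>

definition stewart_le :: "real \<Rightarrow> 'a::metric_space \<Rightarrow> (real \<Rightarrow> 'a) \<Rightarrow> real \<Rightarrow> real \<Rightarrow> bool" where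
  "stewart_le k p c t e \<longleftrightarrow>
     sn k e * (md k (dist p (c 0)) - md k t) + sn k t * (md k (dist p (c (t + e))) - md k e)
       \<le> sn k (t + e) * md k (dist p (c t))"

text \<open>The bound on the radius keeps the perimeter of every triangle in the ball below \<open>2 * pi / sqrt k\<close>, and
  the sum of any two sides below \<open>pi / sqrt k\<close>.\<close>

definition comparison_ball :: "real \<Rightarrow> 'a::metric_space \<Rightarrow> real \<Rightarrow> bool" where
  "comparison_ball k x \<epsilon> \<longleftrightarrow> 0 < \<epsilon> \<and> below_diameter k (4 * \<epsilon>) \<and>
     (\<forall>p c t e. p \<in> ball x \<epsilon> \<longrightarrow> unit_speed c (t + e) \<longrightarrow> 0 \<le> t \<longrightarrow> 0 \<le> e \<longrightarrow>
        c ` {0..t + e} \<subseteq> ball x \<epsilon> \<longrightarrow> stewart_le k p c t e)"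

lemma comparison_ballD:
  assumes "comparison_ball k x \<epsilon>" "dist x p < \<epsilon>" "unit_speed c (t + e)" "0 \<le> t" "0 \<le> e"
    and "\<And>v. 0 \<le> v \<Longrightarrow> v \<le> t + e \<Longrightarrow> dist x (c v) < \<epsilon>"
  shows "stewart_le k p c t e"
  using assms unfolding comparison_ball_def by (auto simp: image_subset_iff)

lemma comparison_ball_shrink:
  assumes "comparison_ball k x \<epsilon>" "0 < \<delta>" "dist x y + \<delta> \<le> \<epsilon>"
  shows "comparison_ball k y \<delta>"
proof -
  have "ball y \<delta> \<subseteq> ball x \<epsilon>"
  proof
    fix z assume "z \<in> ball y \<delta>"
    then show "z \<in> ball x \<epsilon>" using assms(3) dist_triangle[of x z y] by simp
  qed
  moreover have "below_diameter k (4 * \<delta>)"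
    using assms zero_le_dist[of x y] unfolding comparison_ball_def
    by (intro below_diameter_mono[of k "4 * \<epsilon>" "4 * \<delta>"]) linarith+
  ultimately show ?thesis
    using assms(1,2) unfolding comparison_ball_def by (meson subset_iff)
qed

lemma model_dist_polar_ray:
  assumes "0 \<le> s" "0 \<le> t" "below_diameter k s" "below_diameter k t"
  shows "model_dist k (polar k s u) (polar k t u) = \<bar>s - t\<bar>"
proof (rule model_dist_polar)
  show "md k \<bar>s - t\<bar> = md k (s + t) - sn k s * sn k t * (1 + cos (u - u))"
    by (simp add: md_diff)
qed (use assms in \<open>auto simp: below_diameter_def\<close>)

text \<open>The comparison triangle is built in polar coordinates around the vertex that corresponds to \<open>c 0\<close>;
  by \<open>stewart_model\<close> its distances satisfy the equality that becomes \<open>stewart_le\<close>.\<close>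

lemma alexandrov_comparison_ball:
  fixes x :: "'a::metric_space"
  assumes "alexandrov_space k (UNIV :: 'a set) dist"
  shows "\<exists>\<epsilon>. comparison_ball k x \<epsilon>"
proof -
  obtain U where U: "open U \<and> x \<in> U \<and> (\<forall>p\<in>U. \<forall>q r S. min_geodesic UNIV dist q r S \<and> S \<subseteq> U \<and>
          (k > 0 \<longrightarrow> dist p q + dist p r + dist q r < 2 * pi / sqrt k) \<longrightarrow>
          (\<forall>p'\<in>model_plane k. \<forall>q' r' S'.
             min_geodesic (model_plane k) (model_dist k) q' r' S' \<and>
             model_dist k p' q' = dist p q \<and> model_dist k p' r' = dist p r \<and>
             model_dist k q' r' = dist q r \<longrightarrow>
             (\<forall>s\<in>S. \<forall>s'\<in>S'. dist q s = model_dist k q' s' \<longrightarrow> dist p s \<ge> model_dist k p' s')))"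
    using assms[unfolded alexandrov_space_def openin_mtopology_eq_open, THEN conjunct2, THEN conjunct2,
      THEN bspec, OF UNIV_I[of x]] by (rule exE)
  note cmp = U[THEN conjunct2, THEN conjunct2,rule_format, OF _ conjI[OF _ conjI] _ conjI[OF _ conjI[OF _ conjI]]]
  obtain \<rho> where \<rho>: "\<rho> > 0" "ball x \<rho> \<subseteq> U" using U[THEN conjunct1] U[THEN conjunct2, THEN conjunct1] open_contains_ball by blast
  \<comment> \<open>Four radii have to be strictly less than the diameter of the model plane, hence the divisor \<open>5\<close>.\<close>
  define \<epsilon> where "\<epsilon> = (if k > 0 then min \<rho> (pi / sqrt k / 5) else \<rho>)"
  have \<epsilon>: "0 < \<epsilon>" "\<epsilon> \<le> \<rho>" "k > 0 \<Longrightarrow> 5 * \<epsilon> \<le> pi / sqrt k"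
    using \<rho> by (auto simp: \<epsilon>_def)
  have bl: "below_diameter k (4 * \<epsilon>)" using \<epsilon>(1,3) unfolding below_diameter_def by auto
  have "stewart_le k p c t e" if p: "p \<in> ball x \<epsilon>" and c: "unit_speed c (t + e)" and te: "0 \<le> t" "0 \<le> e"
    and sub: "c ` {0..t + e} \<subseteq> ball x \<epsilon>" for p c t e
  proof -
    let ?l = "t + e"
    define a b where "a = dist p (c 0)" and "b = dist p (c ?l)"
    have c0: "dist x (c 0) < \<epsilon>" and cl: "dist x (c ?l) < \<epsilon>" using sub te by (auto simp: image_subset_iff)
    have l: "dist (c 0) (c ?l) = ?l" using unit_speed_dist[OF c, of 0 ?l] te by simp
    have small: "a < 2 * \<epsilon>" "b < 2 * \<epsilon>" "?l < 2 * \<epsilon>"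
      using p c0 cl l dist_triangle[of p "c 0" x] dist_triangle[of p "c ?l" x] dist_triangle[of "c 0" "c ?l" x]
      by (auto simp: a_def b_def dist_commute)
    have belows: "below_diameter k a" "below_diameter k b" "below_diameter k ?l" "below_diameter k t" "below_diameter k (a + ?l)"
      using small te by (auto intro: below_diameter_mono[OF bl])
    have "b \<le> a + ?l" "\<bar>a - ?l\<bar> \<le> b"
      using dist_triangle[of p "c ?l" "c 0"] dist_triangle[of p "c 0" "c ?l"] dist_triangle[of "c 0" "c ?l" p] l
      by (auto simp: a_def b_def dist_commute)
    then obtain y where y: "\<bar>y\<bar> \<le> 1" "md k b = md k (a + ?l) - sn k a * sn k ?l * (1 + y)"
      using hinge_cosine_exists[of a ?l k b] belows te by (auto simp: a_def)
    define P where "P u = polar k u 0" for u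
    define p' where "p' = polar k a (arccos y)"
    have P: "model_dist k (P u) (P v) = \<bar>u - v\<bar>" if "u \<in> {0..?l}" "v \<in> {0..?l}" for u v
      unfolding P_def using that belows(3) by (intro model_dist_polar_ray) (auto elim: below_diameter_mono)
    have geo: "min_geodesic (model_plane k) (model_dist k) (P 0) (P ?l) (P ` {0..?l})"
      by (rule Metric_space.unit_speed_min_geodesic[OF Metric_space_model])
        (use P te in \<open>auto simp: P_def polar_in_model\<close>)
    have pq: "model_dist k p' (P 0) = a"
      unfolding p'_def P_def
      by (rule model_dist_polar) (use belows in \<open>auto simp: a_def below_diameter_def\<close>)
    have pr: "model_dist k p' (P ?l) = b"
      unfolding p'_def P_def
      by (rule model_dist_polar) (use belows y in \<open>auto simp: b_def below_diameter_def cos_arccos_abs\<close>)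
    have st: "model_dist k p' (P t) \<le> dist p (c t)"
    proof (rule cmp[OF _ unit_speed_imp_min_geodesic[OF c] _ _ _ geo])
      show "p \<in> U" "c ` {0..?l} \<subseteq> U" "p' \<in> model_plane k"
        using p sub \<rho>(2) \<epsilon>(2) subset_ball[of \<epsilon> \<rho> x] by (auto simp: p'_def polar_in_model)
      show "model_dist k p' (P 0) = dist p (c 0)" "model_dist k p' (P ?l) = dist p (c ?l)"
        using pq pr by (simp_all add: a_def b_def)
      show "model_dist k (P 0) (P ?l) = dist (c 0) (c ?l)" "dist (c 0) (c t) = model_dist k (P 0) (P t)"
        using P te l unit_speed_dist[OF c] by auto
      show "c t \<in> c ` {0..?l}" "P t \<in> P ` {0..?l}" using te by auto
      show "k > 0 \<longrightarrow> dist p (c 0) + dist p (c ?l) + dist (c 0) (c ?l) < 2 * pi / sqrt k"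
        using small l \<epsilon> unfolding a_def b_def by (auto simp: mult.assoc[symmetric])
    qed
    have pt: "dist p (c t) < 2 * \<epsilon>"
    proof -
      have "dist x (c t) < \<epsilon>" using sub te by (auto simp: image_subset_iff)
      then show ?thesis using p dist_triangle[of p "c t" x] by (simp add: dist_commute)
    qed
    have "md k (model_dist k p' (P t)) \<le> md k (dist p (c t))"
    proof (rule md_mono[OF _ st])
      show "0 \<le> model_dist k p' (P t)"
        by (simp add: model_dist_bounds polar_in_model p'_def P_def)
      show "k > 0 \<Longrightarrow> dist p (c t) \<le> pi / sqrt k" using pt \<epsilon> by auto
    qed
    then have "sn k ?l * md k (model_dist k p' (P t)) \<le> sn k ?l * md k (dist p (c t))"
      using te belows by (intro mult_left_mono sn_nonneg) auto
    moreover have "sn k ?l * md k (model_dist k p' (P t))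
      = sn k e * (md k (model_dist k p' (P 0)) - md k t) + sn k t * (md k (model_dist k p' (P ?l)) - md k e)"
      by (rule stewart_model) (use P te in \<open>auto simp: P_def p'_def polar_in_model\<close>)
    ultimately show ?thesis
      unfolding stewart_le_def pq pr a_def b_def by simp
  qed
  then show ?thesis using \<epsilon>(1) bl unfolding comparison_ball_def by blast
qed

text \<open>A comparison ball contains smaller ones around each of its points, so this is the existence of a
  Lebesgue number.\<close>

lemma comparison_ball_uniform:
  fixes K :: "'a::metric_space set"
  assumes "compact K" "\<And>x. x \<in> K \<Longrightarrow> \<exists>\<epsilon>. comparison_ball k x \<epsilon>"
  obtains \<epsilon> where "\<epsilon> > 0" "\<And>x. x \<in> K \<Longrightarrow> comparison_ball k x \<epsilon>"
proof -
  from assms(2) obtain r where r: "\<And>x. x \<in> K \<Longrightarrow> comparison_ball k x (r x)" by metis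
  then have r0: "r x > 0" if "x \<in> K" for x using that by (auto simp: comparison_ball_def)
  have "K \<subseteq> (\<Union>x\<in>K. ball x (r x / 2))" using r0 by force
  from compactE_image[OF assms(1), of K, OF _ this]
  obtain F where F: "F \<subseteq> K" "finite F" "K \<subseteq> (\<Union>x\<in>F. ball x (r x / 2))" by auto
  define \<delta> where "\<delta> = Min (insert 1 ((\<lambda>x. r x / 2) ` F))"
  have \<delta>: "\<delta> > 0" using F r0 by (auto simp: \<delta>_def)
  have \<delta>le: "\<delta> \<le> r x / 2" if "x \<in> F" for x
    unfolding \<delta>_def using F that by (intro Min_le) auto
  have "comparison_ball k y \<delta>" if "y \<in> K" for y
  proof -
    obtain z where z: "z \<in> F" "dist z y < r z / 2" using F \<open>y \<in> K\<close> by auto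
    then show ?thesis
      using comparison_ball_shrink[OF r \<delta>, of z y] F(1) \<delta>le[of z] by auto
  qed
  with \<delta> show ?thesis using that by blast
qed

section \<open>Angles\<close>

text \<open>The cosine of the angle between the sides \<open>a\<close> and \<open>b\<close> of the model triangle with third side \<open>c\<close>.\<close>

definition comparison_cos :: "real \<Rightarrow> real \<Rightarrow> real \<Rightarrow> real \<Rightarrow> real" where
  "comparison_cos k a b c = (md k (a + b) - md k c) / (sn k a * sn k b) - 1"

text \<open>The angle between two geodesics that start at the same point, through its cosine. The two lengths
  tend to zero together; by monotonicity the full limit in both lengths has the same value.\<close>

definition angle_cos :: "real \<Rightarrow> (real \<Rightarrow> 'a::metric_space) \<Rightarrow> (real \<Rightarrow> 'a) \<Rightarrow> real" where
  "angle_cos k \<alpha> \<beta> = Lim (at_right 0) (\<lambda>t. comparison_cos k t t (dist (\<alpha> t) (\<beta> t)))"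

lemma comparison_cos_commute: "comparison_cos k a b c = comparison_cos k b a c"
  by (simp add: comparison_cos_def add.commute mult.commute)

lemma unit_speed_mono: "unit_speed c l \<Longrightarrow> 0 \<le> l' \<Longrightarrow> l' \<le> l \<Longrightarrow> unit_speed c l'"
  by (auto simp: unit_speed_def)

lemma unit_speed_shift:
  assumes "unit_speed c l" "0 \<le> u" "0 \<le> l'" "u + l' \<le> l" shows "unit_speed (\<lambda>t. c (u + t)) l'"
  using assms by (auto simp: unit_speed_def)

lemma unit_speed_reverse:
  assumes "unit_speed c l" "0 \<le> u" "u \<le> l" shows "unit_speed (\<lambda>t. c (u - t)) u"
  using assms by (auto simp: unit_speed_def)

text \<open>This is \<open>stewart_le\<close> read as a statement on angles: a point on the opposite side that is farther away
  than in the model triangle is seen under a larger angle from the vertex.\<close>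

lemma comparison_cos_mono_right:
  assumes cb: "comparison_ball k x \<epsilon>" and \<alpha>: "unit_speed \<alpha> a" "\<alpha> 0 = x" and \<beta>: "unit_speed \<beta> b" "\<beta> 0 = x"
    and s: "0 < s" "s \<le> a" "s < \<epsilon>" and t: "0 < t" "t \<le> t'" "t' \<le> b" "t' < \<epsilon>"
  shows "comparison_cos k s t (dist (\<alpha> s) (\<beta> t)) \<le> comparison_cos k s t' (dist (\<alpha> s) (\<beta> t'))"
proof -
  define e where "e = t' - t"
  have e: "t' = t + e" "0 \<le> e" using t by (auto simp: e_def)
  have "stewart_le k (\<alpha> s) \<beta> t e"
  proof (rule comparison_ballD[OF cb])
    show "dist x (\<alpha> s) < \<epsilon>" using unit_speed_dist[OF \<alpha>(1), of 0 s] s \<alpha>(2) by auto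
    show "unit_speed \<beta> (t + e)" using unit_speed_mono[OF \<beta>(1)] t e by auto
    fix v assume "0 \<le> v" "v \<le> t + e"
    then show "dist x (\<beta> v) < \<epsilon>" using unit_speed_dist[OF \<beta>(1), of 0 v] t e \<beta>(2) by auto
  qed (use t e in auto)
  moreover have "dist (\<alpha> s) (\<beta> 0) = s"
    using unit_speed_dist[OF \<alpha>(1), of s 0] s \<alpha>(2) \<beta>(2) by auto
  ultimately have *: "sn k t' * (md k (s + t) - md k (dist (\<alpha> s) (\<beta> t)))
      \<le> sn k t * (md k (s + t') - md k (dist (\<alpha> s) (\<beta> t')))"
    using stewart_collinear[of k t e s] unfolding stewart_le_def e(1)
    by (simp add: algebra_simps)
  have "below_diameter k (4 * \<epsilon>)" using cb by (simp add: comparison_ball_def)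
  then have "sn k s > 0" "sn k t > 0" "sn k t' > 0"
    using s t by (auto intro!: sn_pos elim!: below_diameter_mono)
  then have A: "sn k s * sn k t > 0" and B: "sn k s * sn k t' > 0" by auto
  have "(md k (s + t) - md k (dist (\<alpha> s) (\<beta> t))) * (sn k s * sn k t')
      \<le> (md k (s + t') - md k (dist (\<alpha> s) (\<beta> t'))) * (sn k s * sn k t)"
    using mult_left_mono[OF *, of "sn k s"] \<open>sn k s > 0\<close> by (simp add: mult_ac)
  then show ?thesis
    unfolding comparison_cos_def diff_le_eq diff_add_cancel pos_divide_le_eq[OF A] times_divide_eq_left pos_le_divide_eq[OF B]
    by simp
qed

lemma comparison_cos_mono:
  assumes cb: "comparison_ball k x \<epsilon>" and \<alpha>: "unit_speed \<alpha> a" "\<alpha> 0 = x" and \<beta>: "unit_speed \<beta> b" "\<beta> 0 = x"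
    and s: "0 < s" "s \<le> s'" "s' \<le> a" "s' < \<epsilon>" and t: "0 < t" "t \<le> t'" "t' \<le> b" "t' < \<epsilon>"
  shows "comparison_cos k s t (dist (\<alpha> s) (\<beta> t)) \<le> comparison_cos k s' t' (dist (\<alpha> s') (\<beta> t'))"
proof -
  have "comparison_cos k s t (dist (\<alpha> s) (\<beta> t)) \<le> comparison_cos k s t' (dist (\<alpha> s) (\<beta> t'))"
    using s t by (intro comparison_cos_mono_right[OF cb \<alpha> \<beta>]) auto
  also have "\<dots> \<le> comparison_cos k s' t' (dist (\<alpha> s') (\<beta> t'))"
    using comparison_cos_mono_right[OF cb \<beta> \<alpha>, of t' s s'] s t by (simp add: comparison_cos_commute dist_commute)
  finally show ?thesis .
qed

lemma comparison_cos_ge: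
  assumes "0 < a" "0 < b" "below_diameter k (a + b)" "0 \<le> c" "c \<le> a + b"
  shows "-1 \<le> comparison_cos k a b c"
proof -
  have "md k c \<le> md k (a + b)" using assms by (intro md_mono) (auto simp: below_diameter_def)
  moreover have "0 \<le> sn k a * sn k b"
    using assms by (intro mult_nonneg_nonneg sn_nonneg) (auto elim: below_diameter_mono)
  ultimately show ?thesis by (simp add: comparison_cos_def)
qed

text \<open>The comparison cosine decreases as the lengths decrease to zero, so the cosine of the angle is its
  infimum. The inequality is the hinge comparison for short hinges.\<close>

lemma
  assumes cb: "comparison_ball k x \<epsilon>" and \<alpha>: "unit_speed \<alpha> a" "\<alpha> 0 = x" "0 < a" and \<beta>: "unit_speed \<beta> b" "\<beta> 0 = x" "0 < b"
  shows angle_cos_tendsto: "((\<lambda>t. comparison_cos k t t (dist (\<alpha> t) (\<beta> t))) \<longlongrightarrow> angle_cos k \<alpha> \<beta>) (at_right 0)"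
    and angle_cos_le: "\<And>s t. 0 < s \<Longrightarrow> s \<le> a \<Longrightarrow> s < \<epsilon> \<Longrightarrow> 0 < t \<Longrightarrow> t \<le> b \<Longrightarrow> t < \<epsilon>
      \<Longrightarrow> angle_cos k \<alpha> \<beta> \<le> comparison_cos k s t (dist (\<alpha> s) (\<beta> t))"
proof -
  define D where "D t = comparison_cos k t t (dist (\<alpha> t) (\<beta> t))" for t
  define m where "m = min \<epsilon> (min a b)"
  have \<epsilon>: "\<epsilon> > 0" "below_diameter k (4 * \<epsilon>)" using cb by (auto simp: comparison_ball_def)
  have m: "0 < m" using \<alpha> \<beta> \<epsilon> by (simp add: m_def)
  define L where "L = Inf (D ` {0<..<m})"
  have lower: "-1 \<le> D t" if "t \<in> {0<..<m}" for t
    unfolding D_def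
  proof (rule comparison_cos_ge)
    have "dist x (\<alpha> t) = t" "dist x (\<beta> t) = t"
      using unit_speed_dist[OF \<alpha>(1), of 0 t] unit_speed_dist[OF \<beta>(1), of 0 t] \<alpha> \<beta> that by (auto simp: m_def)
    then show "dist (\<alpha> t) (\<beta> t) \<le> t + t" using dist_triangle[of "\<alpha> t" "\<beta> t" x] by (simp add: dist_commute)
    show "below_diameter k (t + t)" using that by (auto simp: m_def intro!: below_diameter_mono[OF \<epsilon>(2)])
  qed (use that in auto)
  then have bdd: "bdd_below (D ` {0<..<m})" by (auto intro!: bdd_belowI[of _ "-1"])
  have LD: "L \<le> D t" if "t \<in> {0<..<m}" for t
    unfolding L_def using bdd that by (intro cInf_lower) auto
  have "(D \<longlongrightarrow> L) (at_right 0)"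
  proof (rule order_tendstoI)
    fix y assume "y < L"
    then show "\<forall>\<^sub>F t in at_right 0. y < D t"
      unfolding eventually_at_right_field using m LD by (intro exI[of _ m]) force
  next
    fix y assume "L < y"
    moreover have "D ` {0<..<m} \<noteq> {}" using m by simp
    ultimately have "\<exists>z\<in>D ` {0<..<m}. z < y" unfolding L_def by (intro cInf_lessD)
    then obtain u where u: "u \<in> {0<..<m}" "D u < y" by auto
    have "D t < y" if "0 < t" "t < u" for t
    proof -
      have "D t \<le> D u" unfolding D_def
        by (rule comparison_cos_mono[OF cb \<alpha>(1,2) \<beta>(1,2)]) (use that u in \<open>auto simp: m_def\<close>)
      with u show ?thesis by simp
    qed
    then show "\<forall>\<^sub>F t in at_right 0. D t < y"
      unfolding eventually_at_right_field using u by (intro exI[of _ u]) auto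
  qed
  moreover from this have "angle_cos k \<alpha> \<beta> = L"
    unfolding angle_cos_def D_def by (intro tendsto_Lim) auto
  ultimately show "((\<lambda>t. comparison_cos k t t (dist (\<alpha> t) (\<beta> t))) \<longlongrightarrow> angle_cos k \<alpha> \<beta>) (at_right 0)"
    unfolding D_def by metis
  fix s t assume st: "0 < s" "s \<le> a" "s < \<epsilon>" "0 < t" "t \<le> b" "t < \<epsilon>"
  define r where "r = min s t / 2"
  have r: "0 < r" "r < s" "r < t" using st by (auto simp: r_def min_def)
  have "L \<le> D r" using r st by (intro LD) (auto simp: m_def)
  also have "\<dots> \<le> comparison_cos k s t (dist (\<alpha> s) (\<beta> t))" unfolding D_def
    by (rule comparison_cos_mono[OF cb \<alpha>(1,2) \<beta>(1,2)]) (use r st in auto)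
  finally show "angle_cos k \<alpha> \<beta> \<le> comparison_cos k s t (dist (\<alpha> s) (\<beta> t))"
    using \<open>angle_cos k \<alpha> \<beta> = L\<close> by simp
qed

text \<open>The two angles that a geodesic makes with the two directions of another one through the same inner
  point add up to at most \<open>\<pi>\<close>. Otherwise, at small scale, the midpoint of \<open>[c (u - t), c (u + t)]\<close> would
  be closer to \<open>\<alpha> t\<close> than in the model triangle.\<close>

lemma angle_cos_adjacent:
  assumes cb: "comparison_ball k x \<epsilon>" and \<alpha>: "unit_speed \<alpha> a" "\<alpha> 0 = x" "0 < a"
    and c: "unit_speed c l" "c u = x" "0 < u" "u < l"
  shows "0 \<le> angle_cos k \<alpha> (\<lambda>t. c (u + t)) + angle_cos k \<alpha> (\<lambda>t. c (u - t))"
proof (rule tendsto_lowerbound)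
  have p: "unit_speed (\<lambda>t. c (u + t)) (l - u)" and n: "unit_speed (\<lambda>t. c (u - t)) u"
    using unit_speed_shift[OF c(1), of u "l - u"] unit_speed_reverse[OF c(1), of u] c by auto
  show "((\<lambda>t. comparison_cos k t t (dist (\<alpha> t) (c (u + t))) + comparison_cos k t t (dist (\<alpha> t) (c (u - t))))
    \<longlongrightarrow> angle_cos k \<alpha> (\<lambda>t. c (u + t)) + angle_cos k \<alpha> (\<lambda>t. c (u - t))) (at_right 0)"
    using c by (intro tendsto_add angle_cos_tendsto[OF cb \<alpha> p] angle_cos_tendsto[OF cb \<alpha> n]) auto
  have \<epsilon>: "\<epsilon> > 0" "below_diameter k (4 * \<epsilon>)" using cb by (auto simp: comparison_ball_def)
  define m where "m = Min {\<epsilon>, a, u, l - u}"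
  have "0 \<le> comparison_cos k t t (dist (\<alpha> t) (c (u + t))) + comparison_cos k t t (dist (\<alpha> t) (c (u - t)))" if t: "0 < t" "t < m" for t
  proof -
    have tm: "t < \<epsilon>" "t < a" "t < u" "t < l - u" using t by (auto simp: m_def)
    have "stewart_le k (\<alpha> t) (\<lambda>v. c (u - t + v)) t t"
    proof (rule comparison_ballD[OF cb])
      show "dist x (\<alpha> t) < \<epsilon>" using unit_speed_dist[OF \<alpha>(1), of 0 t] t tm \<alpha>(2) by auto
      show "unit_speed (\<lambda>v. c (u - t + v)) (t + t)" using t tm by (intro unit_speed_shift[OF c(1)]) auto
      fix v assume "0 \<le> v" "v \<le> t + t"
      then show "dist x (c (u - t + v)) < \<epsilon>"
        using unit_speed_dist[OF c(1), of u "u - t + v"] c(2-) t tm by auto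
    qed (use t in auto)
    moreover have "dist (\<alpha> t) x = t" using unit_speed_dist[OF \<alpha>(1), of t 0] t tm \<alpha>(2) by auto
    ultimately have "sn k t * (md k (dist (\<alpha> t) (c (u - t))) + md k (dist (\<alpha> t) (c (u + t))))
       \<le> sn k t * (2 * md k t + 2 * cs k t * md k t)"
      unfolding stewart_le_def sn_add using c(2) by (simp add: algebra_simps)
    moreover have sn: "sn k t > 0" using t tm by (auto intro!: sn_pos below_diameter_mono[OF \<epsilon>(2)])
    ultimately have "md k (dist (\<alpha> t) (c (u - t))) + md k (dist (\<alpha> t) (c (u + t))) \<le> 2 * md k t + 2 * cs k t * md k t"
      by simp
    then have "0 \<le> (2 * md k (t + t) - (md k (dist (\<alpha> t) (c (u - t))) + md k (dist (\<alpha> t) (c (u + t)))))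
        - 2 * (sn k t * sn k t)"
      unfolding md_add by (simp add: algebra_simps)
    then have "0 \<le> ((2 * md k (t + t) - (md k (dist (\<alpha> t) (c (u - t))) + md k (dist (\<alpha> t) (c (u + t)))))
        - 2 * (sn k t * sn k t)) / (sn k t * sn k t)"
      using sn by (intro divide_nonneg_pos) auto
    also have "\<dots> = comparison_cos k t t (dist (\<alpha> t) (c (u + t))) + comparison_cos k t t (dist (\<alpha> t) (c (u - t)))"
      using sn by (simp add: comparison_cos_def field_simps)
    finally show ?thesis .
  qed
  moreover have "m > 0" using \<epsilon> \<alpha> c by (auto simp: m_def)
  ultimately show "\<forall>\<^sub>F t in at_right 0. 0 \<le> comparison_cos k t t (dist (\<alpha> t) (c (u + t))) + comparison_cos k t t (dist (\<alpha> t) (c (u - t)))"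
    unfolding eventually_at_right_field by blast
qed simp

section \<open>From short hinges to long hinges\<close>

definition hinge_le :: "real \<Rightarrow> (real \<Rightarrow> 'a::metric_space) \<Rightarrow> real \<Rightarrow> (real \<Rightarrow> 'a) \<Rightarrow> real \<Rightarrow> bool" where
  "hinge_le k \<alpha> a \<beta> b \<longleftrightarrow>
     md k (dist (\<alpha> a) (\<beta> b)) \<le> md k (a + b) - sn k a * sn k b * (1 + angle_cos k \<alpha> \<beta>)"

lemma hinge_le_iff_comparison_cos:
  assumes "0 < a" "0 < b" "below_diameter k a" "below_diameter k b"
  shows "hinge_le k \<alpha> a \<beta> b \<longleftrightarrow> angle_cos k \<alpha> \<beta> \<le> comparison_cos k a b (dist (\<alpha> a) (\<beta> b))"
proof -
  have "sn k a * sn k b > 0" using assms by (intro mult_pos_pos sn_pos)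
  then show ?thesis unfolding hinge_le_def comparison_cos_def by (auto simp: field_simps)
qed

lemma angle_cos_commute: "angle_cos k \<alpha> \<beta> = angle_cos k \<beta> \<alpha>"
  by (simp add: angle_cos_def dist_commute)

text \<open>\<open>md\<close> of the third side of the model hinge with the same sides and the same angle.\<close>

definition hinge_side :: "real \<Rightarrow> (real \<Rightarrow> 'a::metric_space) \<Rightarrow> real \<Rightarrow> (real \<Rightarrow> 'a) \<Rightarrow> real \<Rightarrow> real" where
  "hinge_side k \<alpha> a \<beta> b = md k (a + b) - sn k a * sn k b * (1 + angle_cos k \<alpha> \<beta>)"

lemma hinge_le_side: "hinge_le k \<alpha> a \<beta> b \<longleftrightarrow> md k (dist (\<alpha> a) (\<beta> b)) \<le> hinge_side k \<alpha> a \<beta> b"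
  by (simp add: hinge_le_def hinge_side_def)

lemma hinge_side_commute: "hinge_side k \<alpha> a \<beta> b = hinge_side k \<beta> b \<alpha> a"
  by (simp add: hinge_side_def angle_cos_commute[of k \<alpha>] add.commute mult.commute)

definition hinges_upto :: "real \<Rightarrow> 'a::metric_space set \<Rightarrow> real \<Rightarrow> bool" where
  "hinges_upto k A L \<longleftrightarrow> (\<forall>\<alpha> \<beta> a b. unit_speed \<alpha> a \<longrightarrow> unit_speed \<beta> b \<longrightarrow> \<alpha> 0 = \<beta> 0 \<longrightarrow> 0 < a \<longrightarrow> 0 < b \<longrightarrow>
     a + b < L \<longrightarrow> \<alpha> 0 \<in> A \<longrightarrow> hinge_le k \<alpha> a \<beta> b)"

lemma hinges_uptoD:
  assumes "hinges_upto k A L" "unit_speed \<alpha> a" "unit_speed \<beta> b" "\<alpha> 0 = \<beta> 0" "0 < a" "0 < b" "a + b < L" "\<alpha> 0 \<in> A"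
  shows "md k (dist (\<alpha> a) (\<beta> b)) \<le> md k (a + b) - sn k a * sn k b * (1 + angle_cos k \<alpha> \<beta>)"
  using assms unfolding hinges_upto_def hinge_le_def by blast

lemma hinges_upto_local:
  assumes "\<And>x. x \<in> A \<Longrightarrow> comparison_ball k x \<epsilon>"
  shows "hinges_upto k A \<epsilon>"
  unfolding hinges_upto_def
proof (intro allI impI)
  fix \<alpha> \<beta> :: "real \<Rightarrow> 'a" and a b
  assume h: "unit_speed \<alpha> a" "unit_speed \<beta> b" "\<alpha> 0 = \<beta> 0" "0 < a" "0 < b" "a + b < \<epsilon>" "\<alpha> 0 \<in> A"
  then have cb: "comparison_ball k (\<alpha> 0) \<epsilon>" using assms by blast
  then have "below_diameter k (4 * \<epsilon>)" by (simp add: comparison_ball_def)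
  then have "below_diameter k a" "below_diameter k b" using h by (auto intro: below_diameter_mono)
  then show "hinge_le k \<alpha> a \<beta> b"
    using angle_cos_le[OF cb h(1) refl h(4,2) h(3)[symmetric] h(5), of a b] h by (simp add: hinge_le_iff_comparison_cos)
qed

text \<open>The constant that controls the error for an almost straight hinge: \<open>b\<close> is its longer side, \<open>u\<close> the
  length cut off from that side, and \<open>w - v\<close> the decrease of the total length. It exists because \<open>u\<close>
  stays away from \<open>0\<close> and from the zeros of \<open>sn k\<close>.\<close>

lemma short_hinge_constant:
  assumes l: "0 < l" "k > 0 \<Longrightarrow> l \<le> pi / sqrt k"
  obtains M where "0 \<le> M" "\<And>b u v w. 0 \<le> b \<Longrightarrow> b < l \<Longrightarrow> l / 18 \<le> u \<Longrightarrow> u \<le> l / 2 \<Longrightarrow> 0 \<le> v \<Longrightarrow> v \<le> w \<Longrightarrow> w < l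
    \<Longrightarrow> sn k b * (md k w - md k v) / sn k u \<le> M * (w - v)"
proof -
  have bl: "below_diameter k x" if "x < l" for x using that l by (auto simp: below_diameter_def)
  have "bounded (sn k ` {0..l})"
    by (intro compact_imp_bounded compact_continuous_image continuous_sn) simp
  then obtain B where B: "0 < B" "\<And>x. x \<in> {0..l} \<Longrightarrow> \<bar>sn k x\<bar> \<le> B"
    unfolding bounded_pos by auto
  have "{l/18..l/2} \<noteq> {}" using l by simp
  from continuous_attains_inf[OF compact_Icc this continuous_sn[of _ k]]
  obtain m where m: "m \<in> {l/18..l/2}" "\<And>u. u \<in> {l/18..l/2} \<Longrightarrow> sn k m \<le> sn k u" by blast
  define \<sigma> where "\<sigma> = sn k m"
  have \<sigma>: "\<sigma> > 0" unfolding \<sigma>_def using m(1) l by (intro sn_pos bl) auto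
  have "sn k b * (md k w - md k v) / sn k u \<le> B * B / \<sigma> * (w - v)"
    if b: "0 \<le> b" "b < l" and u: "l / 18 \<le> u" "u \<le> l / 2" and v: "0 \<le> v" "v \<le> w" and w: "w < l" for b u v w
  proof -
    have 1: "md k w - md k v \<le> B * (w - v)"
    proof (cases "v = w")
      case False
      with v have "v < w" by simp
      from MVT2[OF this DERIV_md] obtain z where z: "v < z" "z < w" "md k w - md k v = (w - v) * sn k z" by blast
      have "sn k z \<le> B" using B(2)[of z] z v w by auto
      then show ?thesis using z(3) \<open>v < w\<close> by (simp add: mult.commute mult_left_mono)
    qed simp
    have "k > 0 \<Longrightarrow> w \<le> pi / sqrt k" using w l(2) by force
    then have 0: "0 \<le> md k w - md k v" using md_mono[of v w k] v by simp
    have "sn k b * (md k w - md k v) \<le> B * (B * (w - v))"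
      using B(2)[of b] b 0 1 B(1) by (intro mult_mono) auto
    moreover have "0 \<le> B * (B * (w - v))" using B(1) v by simp
    moreover have "\<sigma> \<le> sn k u" unfolding \<sigma>_def using m(2) u by simp
    ultimately have "sn k b * (md k w - md k v) / sn k u \<le> B * (B * (w - v)) / \<sigma>"
      using \<sigma> by (intro frac_le) auto
    then show ?thesis by (simp add: mult.assoc)
  qed
  moreover have "0 \<le> B * B / \<sigma>" using B \<sigma> by simp
  ultimately show ?thesis using that by blast
qed

text \<open>The vertex moves from \<open>x = \<alpha> 0\<close> to \<open>x' = \<beta> u\<close>. The hinges of the triangle \<open>p, x, x'\<close> at \<open>x\<close> and at \<open>x'\<close> have
  total length below \<open>2 * l / 3\<close>, because \<open>a + 2 * u\<close> is. So the angle at \<open>x\<close> is at least, and the angle at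
  \<open>x'\<close> towards \<open>q\<close> is at most, the one in the model triangle \<open>p, x, x'\<close> prolonged to \<open>q\<close>. By \<open>stewart_hinge\<close> the
  distance from \<open>p\<close> to \<open>q\<close> in that figure lies between the new and the old model distance. The last
  estimate says that a small loss of length forces the hinge to be almost straight.\<close>

lemma short_hinge_step:
  fixes \<alpha> \<beta> :: "real \<Rightarrow> 'a::metric_space"
  assumes geo: "\<And>x y :: 'a. \<exists>c. unit_speed c (dist x y) \<and> c 0 = x \<and> c (dist x y) = y"
    and loc: "\<And>x :: 'a. \<exists>\<epsilon>. comparison_ball k x \<epsilon>"
    and H: "hinges_upto k A (2 / 3 * l)"
    and \<alpha>: "unit_speed \<alpha> a" and \<beta>: "unit_speed \<beta> b" and x: "\<alpha> 0 = \<beta> 0" and a: "0 < a"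
    and u: "0 < u" "u < b" "a + 3 * u = 2 / 3 * l"
    and bl: "below_diameter k (a + 2 * u)" "below_diameter k b"
    and A: "\<alpha> 0 \<in> A" "\<beta> u \<in> A"
  defines "a' \<equiv> dist (\<beta> u) (\<alpha> a)"
  obtains \<alpha>' where "unit_speed \<alpha>' a'" "\<alpha>' 0 = \<beta> u" "\<alpha>' a' = \<alpha> a" "a' \<le> a + u"
    "hinge_side k \<alpha>' a' (\<lambda>t. \<beta> (u + t)) (b - u) \<le> hinge_side k \<alpha> a \<beta> b"
    "md k (a + b) - hinge_side k \<alpha> a \<beta> b \<le> sn k b * (md k (a + u) - md k a') / sn k u"
proof -
  define e where "e = b - u"
  have e: "0 < e" "b = u + e" using u by (auto simp: e_def)
  obtain \<alpha>' where \<alpha>': "unit_speed \<alpha>' a'" "\<alpha>' 0 = \<beta> u" "\<alpha>' a' = \<alpha> a"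
    using geo[of "\<beta> u" "\<alpha> a"] unfolding a'_def by blast
  have xa: "dist (\<alpha> a) (\<beta> 0) = a" using unit_speed_dist[OF \<alpha>, of a 0] a x by simp
  have xu: "dist (\<beta> 0) (\<beta> u) = u" using unit_speed_dist[OF \<beta>, of 0 u] u by simp
  have a'0: "0 \<le> a'" by (simp add: a'_def)
  have a'le: "a' \<le> a + u"
    using dist_triangle[of "\<beta> u" "\<alpha> a" "\<beta> 0"] xa xu by (simp add: a'_def dist_commute)
  have sn: "0 < sn k u" "0 \<le> sn k b" "0 \<le> sn k a'" "0 \<le> sn k e"
    using u a a'le a'0 bl e by (auto intro!: sn_pos sn_nonneg elim: below_diameter_mono)
  define X where "X = (md k (a + u) - md k a') / sn k u"
  define X' where "X' = (md k (a' + u) - md k a) / sn k u"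
  have X: "md k a' = md k (a + u) - sn k u * X" and X': "md k a = md k (a' + u) - sn k u * X'"
    using sn(1) by (simp_all add: X_def X'_def)
  have "md k a' \<le> md k (a + u) - sn k a * sn k u * (1 + angle_cos k \<alpha> \<beta>)"
    using hinges_uptoD[OF H \<alpha> unit_speed_mono[OF \<beta>, of u] x a u(1)] u a A
    by (simp add: a'_def dist_commute)
  then have "sn k u * (sn k a * (1 + angle_cos k \<alpha> \<beta>)) \<le> sn k u * X" using X by (simp add: mult_ac)
  then have hX: "sn k a * (1 + angle_cos k \<alpha> \<beta>) \<le> X" using sn by simp
  have ii: "md k (a + b) - hinge_side k \<alpha> a \<beta> b \<le> sn k b * X"
    using mult_left_mono[OF hX sn(2)] by (simp add: hinge_side_def mult_ac)
  have hX': "2 * sn k a' - X' \<le> sn k a' * (1 + angle_cos k \<alpha>' (\<lambda>t. \<beta> (u + t)))"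
  proof (cases "a' = 0")
    case True
    then have "a = u" using xa xu unfolding a'_def by (simp add: dist_commute)
    then show ?thesis using True by (simp add: X'_def)
  next
    case False
    then have a'pos: "0 < a'" using a'0 by simp
    have "md k (dist (\<alpha>' a') (\<beta> (u - u)))
        \<le> md k (a' + u) - sn k a' * sn k u * (1 + angle_cos k \<alpha>' (\<lambda>t. \<beta> (u - t)))"
      using hinges_uptoD[OF H \<alpha>'(1) unit_speed_reverse[OF \<beta>, of u] _ a'pos u(1)] u a A \<alpha>' a'le by simp
    then have "sn k u * (sn k a' * (1 + angle_cos k \<alpha>' (\<lambda>t. \<beta> (u - t)))) \<le> sn k u * X'"
      using X' \<alpha>'(3) xa by (simp add: mult_ac)
    then have 1: "sn k a' * (1 + angle_cos k \<alpha>' (\<lambda>t. \<beta> (u - t))) \<le> X'" using sn by simp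
    obtain \<epsilon> where "comparison_ball k (\<beta> u) \<epsilon>" using loc by blast
    from angle_cos_adjacent[OF this \<alpha>'(1,2) a'pos \<beta> refl u(1,2)]
    have "sn k a' * (1 - angle_cos k \<alpha>' (\<lambda>t. \<beta> (u - t))) \<le> sn k a' * (1 + angle_cos k \<alpha>' (\<lambda>t. \<beta> (u + t)))"
      using sn(3) by (intro mult_left_mono) auto
    with 1 show ?thesis by (simp add: algebra_simps)
  qed
  have "hinge_side k \<alpha>' a' (\<lambda>t. \<beta> (u + t)) e \<le> md k (a' + e) - sn k e * (2 * sn k a' - X')"
    using mult_left_mono[OF hX' sn(4)] by (simp add: hinge_side_def mult_ac)
  also have "\<dots> = md k (a + u + e) - sn k (u + e) * X"
    using stewart_hinge[OF _ X X', of e] sn(1) by simp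
  also have "\<dots> \<le> hinge_side k \<alpha> a \<beta> b"
    using ii unfolding e(2) by (simp add: add.assoc)
  finally show ?thesis
    using that[OF \<alpha>' a'le] ii unfolding X_def e_def by simp
qed

text \<open>Each step either lowers the total length by \<open>\<delta>\<close>, which lowers \<open>n\<close>, or ends with the error \<open>M * \<delta>\<close>. The
  endpoints never change, and all vertices stay within distance \<open>l\<close> of them, which keeps them in \<open>A\<close>.\<close>

lemma short_hinge_approx:
  fixes \<alpha> \<beta> :: "real \<Rightarrow> 'a::metric_space"
  assumes geo: "\<And>x y :: 'a. \<exists>c. unit_speed c (dist x y) \<and> c 0 = x \<and> c (dist x y) = y"
    and loc: "\<And>x :: 'a. \<exists>\<epsilon>. comparison_ball k x \<epsilon>"
    and H: "hinges_upto k A (2 / 3 * l)"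
    and l: "0 < l" "k > 0 \<Longrightarrow> l \<le> pi / sqrt k"
    and M: "0 \<le> M" "\<And>b u v w. 0 \<le> b \<Longrightarrow> b < l \<Longrightarrow> l / 18 \<le> u \<Longrightarrow> u \<le> l / 2 \<Longrightarrow> 0 \<le> v \<Longrightarrow> v \<le> w \<Longrightarrow> w < l
      \<Longrightarrow> sn k b * (md k w - md k v) / sn k u \<le> M * (w - v)"
    and \<delta>: "0 < \<delta>"
  shows "unit_speed \<alpha> a \<Longrightarrow> unit_speed \<beta> b \<Longrightarrow> \<alpha> 0 = \<beta> 0 \<Longrightarrow> 0 < a \<Longrightarrow> 0 < b \<Longrightarrow> a + b < l \<Longrightarrow>
    cball (\<alpha> a) l \<subseteq> A \<Longrightarrow> cball (\<beta> b) l \<subseteq> A \<Longrightarrow> a + b < real n * \<delta> \<Longrightarrow>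
    md k (dist (\<alpha> a) (\<beta> b)) \<le> hinge_side k \<alpha> a \<beta> b + M * \<delta>"
proof (induction n arbitrary: \<alpha> \<beta> a b)
  case 0
  then show ?case by simp
next
  case (Suc n)
  have main: "md k (dist (\<alpha> a) (\<beta> b)) \<le> hinge_side k \<alpha> a \<beta> b + M * \<delta>"
    if h: "unit_speed \<alpha> a" "unit_speed \<beta> b" "\<alpha> 0 = \<beta> 0" "0 < a" "0 < b" "a + b < l"
      "cball (\<alpha> a) l \<subseteq> A" "cball (\<beta> b) l \<subseteq> A" "a + b < real (Suc n) * \<delta>" and ab: "a \<le> b"
    for \<alpha> \<beta> :: "real \<Rightarrow> 'a" and a b
  proof (cases "a + b < 2 / 3 * l")
    case True
    have "dist (\<alpha> a) (\<alpha> 0) = a" using unit_speed_dist[OF h(1), of a 0] h by simp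
    then have "\<alpha> 0 \<in> A" using h(5-7) by (intro subsetD[OF h(7)]) auto
    then have "md k (dist (\<alpha> a) (\<beta> b)) \<le> hinge_side k \<alpha> a \<beta> b"
      using hinges_uptoD[OF H h(1-5) True] by (simp add: hinge_side_def)
    then show ?thesis using mult_nonneg_nonneg[of M \<delta>] M(1) \<delta> by linarith
  next
    case False
    \<comment> \<open>With this choice \<open>a + 2 * u < 2 / 3 * l\<close>, so both auxiliary hinges are short, and \<open>a < l / 2\<close> gives
      \<open>l / 18 < u\<close>.\<close>
    define u where "u = (2 / 3 * l - a) / 3"
    have u: "a + 3 * u = 2 / 3 * l" by (simp add: u_def field_simps)
    have ub: "0 < u" "u < b" "l / 18 \<le> u" "u \<le> l / 2" using u False h l ab by linarith+
    have bl: "below_diameter k (a + 2 * u)" "below_diameter k b"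
      using u ub h l by (auto simp: below_diameter_def intro: less_le_trans)
    have xa: "dist (\<alpha> a) (\<beta> 0) = a" using unit_speed_dist[OF h(1), of a 0] h by simp
    have xu: "dist (\<beta> 0) (\<beta> u) = u" using unit_speed_dist[OF h(2), of 0 u] ub by simp
    have A: "\<alpha> 0 \<in> A" "\<beta> u \<in> A"
      using dist_triangle[of "\<alpha> a" "\<beta> u" "\<beta> 0"] xa xu u ub h(3-6)
      by (auto intro!: subsetD[OF h(7)])
    let ?a = "dist (\<beta> u) (\<alpha> a)"
    obtain \<alpha>' where \<alpha>': "unit_speed \<alpha>' ?a" "\<alpha>' 0 = \<beta> u" "\<alpha>' ?a = \<alpha> a" "?a \<le> a + u"
      and side: "hinge_side k \<alpha>' ?a (\<lambda>t. \<beta> (u + t)) (b - u) \<le> hinge_side k \<alpha> a \<beta> b"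
      and err: "md k (a + b) - hinge_side k \<alpha> a \<beta> b \<le> sn k b * (md k (a + u) - md k ?a) / sn k u"
      using short_hinge_step[OF geo loc H h(1-4) ub(1,2) u bl A] by blast
    show ?thesis
    proof (cases "a + u - ?a < \<delta>")
      case True
      have "dist (\<alpha> a) (\<beta> b) \<le> a + b"
        using dist_triangle[of "\<alpha> a" "\<beta> b" "\<beta> 0"] xa unit_speed_dist[OF h(2), of 0 b] h(5) by simp
      then have "md k (dist (\<alpha> a) (\<beta> b)) \<le> md k (a + b)"
        using h(6) l by (intro md_mono) auto
      also have "\<dots> \<le> hinge_side k \<alpha> a \<beta> b + M * (a + u - ?a)"
        using M(2)[of b u ?a "a + u"] err h \<alpha>'(4) ub u by auto
      also have "M * (a + u - ?a) \<le> M * \<delta>" using True M(1) by (intro mult_left_mono) auto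
      finally show ?thesis by simp
    next
      case far: False
      show ?thesis
      \<comment> \<open>If \<open>?a = 0\<close>, the new vertex is the endpoint \<open>\<alpha> a\<close> itself and the new hinge has lost one side.\<close>
      proof (cases "?a = 0")
        case True
        have "md k (dist (\<alpha> a) (\<beta> b)) = md k (b - u)"
          using True unit_speed_dist[OF h(2), of u b] ub by (simp add: abs_minus_commute)
        also have "\<dots> = hinge_side k \<alpha>' ?a (\<lambda>t. \<beta> (u + t)) (b - u)"
          using True by (simp add: hinge_side_def)
        also note side
        finally show ?thesis using mult_nonneg_nonneg[of M \<delta>] M(1) \<delta> by linarith
      next
        case False
        have "md k (dist (\<alpha>' ?a) (\<beta> (u + (b - u)))) \<le> hinge_side k \<alpha>' ?a (\<lambda>t. \<beta> (u + t)) (b - u) + M * \<delta>"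
        proof (rule Suc.IH)
          show "unit_speed \<alpha>' ?a" by (rule \<alpha>')
          show "unit_speed (\<lambda>t. \<beta> (u + t)) (b - u)" using ub by (intro unit_speed_shift[OF h(2)]) auto
          show "?a + (b - u) < l" using \<alpha>'(4) h(6) by linarith
          show "?a + (b - u) < real n * \<delta>" using far h(9) by (simp add: algebra_simps)
        qed (use False \<alpha>' h ub in auto)
        with side \<alpha>'(3) show ?thesis by simp
      qed
    qed
  qed
  show ?case
  proof (cases "a \<le> b")
    case True
    then show ?thesis using main Suc.prems by blast
  next
    case False
    then have "md k (dist (\<beta> b) (\<alpha> a)) \<le> hinge_side k \<beta> b \<alpha> a + M * \<delta>"
      using Suc.prems by (intro main) (auto simp: add.commute)
    then show ?thesis by (simp add: dist_commute hinge_side_commute)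
  qed
qed

lemma short_hinge:
  assumes geo: "\<And>x y :: 'a::metric_space. \<exists>c. unit_speed c (dist x y) \<and> c 0 = x \<and> c (dist x y) = y"
    and loc: "\<And>x :: 'a. \<exists>\<epsilon>. comparison_ball k x \<epsilon>"
    and H: "hinges_upto k (cball z (R + 2 * l)) (2 / 3 * l)"
    and l: "0 < l" "k > 0 \<Longrightarrow> l \<le> pi / sqrt k"
  shows "hinges_upto k (cball (z :: 'a) R) l"
  unfolding hinges_upto_def
proof (intro allI impI)
  fix \<alpha> \<beta> :: "real \<Rightarrow> 'a" and a b
  assume h: "unit_speed \<alpha> a" "unit_speed \<beta> b" "\<alpha> 0 = \<beta> 0" "0 < a" "0 < b" "a + b < l" "\<alpha> 0 \<in> cball z R"
  obtain M where M: "0 \<le> M" "\<And>b u v w. 0 \<le> b \<Longrightarrow> b < l \<Longrightarrow> l / 18 \<le> u \<Longrightarrow> u \<le> l / 2 \<Longrightarrow> 0 \<le> v \<Longrightarrow> v \<le> w \<Longrightarrow> w < l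
      \<Longrightarrow> sn k b * (md k w - md k v) / sn k u \<le> M * (w - v)"
    using short_hinge_constant[OF l] by blast
  have ball: "cball y l \<subseteq> cball z (R + 2 * l)" if "dist (\<alpha> 0) y \<le> l" for y
  proof
    fix w assume "w \<in> cball y l"
    then show "w \<in> cball z (R + 2 * l)"
      using that h(7) dist_triangle[of z w y] dist_triangle[of z y "\<alpha> 0"] by simp
  qed
  have balls: "cball (\<alpha> a) l \<subseteq> cball z (R + 2 * l)" "cball (\<beta> b) l \<subseteq> cball z (R + 2 * l)"
    using unit_speed_dist[OF h(1), of 0 a] unit_speed_dist[OF h(2), of 0 b] h(3-6) by (auto intro!: ball)
  have approx: "md k (dist (\<alpha> a) (\<beta> b)) \<le> hinge_side k \<alpha> a \<beta> b + M * \<delta>" if \<delta>: "\<delta> > 0" for \<delta>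
  proof -
    obtain n :: nat where n: "a + b < real n * \<delta>" using reals_Archimedean3[OF \<delta>] by blast
    show ?thesis
      by (rule short_hinge_approx[where n = n, OF geo loc H l(1) _ M(1) _ \<delta> h(1-6) balls n]) (fact l(2) M(2))+
  qed
  have "md k (dist (\<alpha> a) (\<beta> b)) \<le> hinge_side k \<alpha> a \<beta> b"
  proof (rule field_le_epsilon)
    fix e :: real assume e: "e > 0"
    have "md k (dist (\<alpha> a) (\<beta> b)) \<le> hinge_side k \<alpha> a \<beta> b + M * (e / (M + 1))"
      using M(1) e by (intro approx) auto
    also have "M * (e / (M + 1)) \<le> e" using M(1) e by (simp add: field_simps)
    finally show "md k (dist (\<alpha> a) (\<beta> b)) \<le> hinge_side k \<alpha> a \<beta> b + e" by simp
  qed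
  then show "hinge_le k \<alpha> a \<beta> b" by (simp add: hinge_le_side)
qed

text \<open>The radii grow by \<open>2 * l + 2 * (2 / 3) * l + \<dots>\<close>, which stays below \<open>6 * l\<close>.\<close>

lemma hinges_upto_iterate:
  assumes geo: "\<And>x y :: 'a::metric_space. \<exists>c. unit_speed c (dist x y) \<and> c 0 = x \<and> c (dist x y) = y"
    and loc: "\<And>x :: 'a. \<exists>\<epsilon>. comparison_ball k x \<epsilon>"
  shows "hinges_upto k (cball z (R + 6 * l)) ((2 / 3) ^ n * l) \<Longrightarrow> 0 < l \<Longrightarrow> (k > 0 \<Longrightarrow> l \<le> pi / sqrt k)
    \<Longrightarrow> hinges_upto k (cball (z :: 'a) R) l"
proof (induction n arbitrary: R l)
  case 0
  then show ?case unfolding hinges_upto_def by (simp add: order_trans)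
next
  case (Suc n)
  have "hinges_upto k (cball z (R + 2 * l)) (2 / 3 * l)"
  proof (rule Suc.IH)
    have "R + 2 * l + 6 * (2 / 3 * l) = R + 6 * l" by simp
    moreover have "(2 / 3) ^ n * (2 / 3 * l) = (2 / 3) ^ Suc n * l" by simp
    ultimately show "hinges_upto k (cball z (R + 2 * l + 6 * (2 / 3 * l))) ((2 / 3) ^ n * (2 / 3 * l))"
      using Suc.prems(1) by (simp only:)
    show "0 < 2 / 3 * l" using Suc.prems by simp
    show "k > 0 \<Longrightarrow> 2 / 3 * l \<le> pi / sqrt k" using Suc.prems(2,3) by linarith
  qed
  then show ?case using short_hinge[OF geo loc] Suc.prems(2,3) by blast
qed

lemma hinge_comparison:
  fixes \<alpha> \<beta> :: "real \<Rightarrow> 'a::metric_space"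
  assumes geo: "\<And>x y :: 'a. \<exists>c. unit_speed c (dist x y) \<and> c 0 = x \<and> c (dist x y) = y"
    and loc: "\<And>x :: 'a. \<exists>\<epsilon>. comparison_ball k x \<epsilon>"
    and proper: "\<And>(a::'a) R. compact (cball a R)"
    and h: "unit_speed \<alpha> a" "unit_speed \<beta> b" "\<alpha> 0 = \<beta> 0" "0 < a" "0 < b" "below_diameter k (a + b)"
  shows "md k (dist (\<alpha> a) (\<beta> b)) \<le> md k (a + b) - sn k a * sn k b * (1 + angle_cos k \<alpha> \<beta>)"
proof -
  define l where "l = (if k > 0 then pi / sqrt k else a + b + 1)"
  have l: "0 < l" "k > 0 \<Longrightarrow> l \<le> pi / sqrt k" "a + b < l"
    using h by (auto simp: l_def below_diameter_def)
  obtain \<epsilon> where \<epsilon>: "\<epsilon> > 0" "\<And>x. x \<in> cball (\<alpha> 0) (0 + 6 * l) \<Longrightarrow> comparison_ball k x \<epsilon>"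
    using comparison_ball_uniform[OF proper loc] by blast
  obtain n where "(2 / 3) ^ n < \<epsilon> / l"
    using real_arch_pow_inv[of "\<epsilon> / l" "2 / 3"] \<epsilon>(1) l(1) by auto
  then have n: "(2 / 3) ^ n * l < \<epsilon>" using l(1) by (simp add: field_simps)
  have "hinges_upto k (cball (\<alpha> 0) (0 + 6 * l)) \<epsilon>" by (rule hinges_upto_local) (rule \<epsilon>(2))
  then have "hinges_upto k (cball (\<alpha> 0) (0 + 6 * l)) ((2 / 3) ^ n * l)"
    using n unfolding hinges_upto_def by (meson less_trans)
  from hinges_upto_iterate[OF geo loc this l(1,2)]
  have "hinges_upto k (cball (\<alpha> 0) 0) l" by simp
  then show ?thesis using hinges_uptoD h l(3) by (metis centre_in_cball order_refl)
qed

section \<open>Distance functions along a geodesic\<close>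

lemma cs_pos:
  assumes "\<bar>t\<bar> \<le> l / 2" "below_diameter k l" shows "0 < cs k t"
proof (cases "k > 0")
  case True
  have "sqrt k * (2 * \<bar>t\<bar>) < pi"
    using assms True by (auto simp: below_diameter_def field_simps intro: le_less_trans[of _ "l * sqrt k"])
  then have "\<bar>sqrt k * t\<bar> < pi / 2" using True by (simp add: abs_mult)
  then show ?thesis using True by (auto simp: cs_def intro!: cos_gt_zero_pi)
qed (simp add: cs_def)

text \<open>A maximum principle for \<open>z'' + k z \<le> 0\<close> in the barrier sense, on an interval shorter than
  \<open>pi / sqrt k\<close>. On such an interval \<open>w'' + k w = 0\<close> has a positive solution, and at a negative minimum
  \<open>t0\<close> of \<open>z / w\<close> the barrier is squeezed onto a multiple of \<open>w\<close>: the difference is \<open>D * sn k h\<close>, which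
  cannot be nonnegative for both signs of \<open>h\<close> unless \<open>D = 0\<close>. So \<open>z / w\<close> is constant to the right of \<open>t0\<close>,
  which contradicts the choice of \<open>t0\<close> as the last minimum.\<close>

lemma barrier_nonneg:
  assumes cont: "continuous_on {0..l} z" and l: "0 < l" "below_diameter k l" and ends: "0 \<le> z 0" "0 \<le> z l"
    and barrier: "\<And>t. 0 < t \<Longrightarrow> t < l \<Longrightarrow> \<exists>B \<epsilon>. 0 < \<epsilon> \<and> (\<forall>h. \<bar>h\<bar> < \<epsilon> \<longrightarrow> z (t + h) \<le> cs k h * z t + B * sn k h)"
    and t: "t \<in> {0..l}"
  shows "0 \<le> z t"
proof (rule ccontr)
  assume neg: "\<not> 0 \<le> z t"
  \<comment> \<open>Centred at the midpoint of the interval, which makes \<open>w\<close> positive on all of it.\<close>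
  define w where "w s = cs k (s - l / 2)" for s
  have w: "0 < w s" if "s \<in> {0..l}" for s
    unfolding w_def using that by (intro cs_pos[OF _ l(2)]) (auto simp: abs_le_iff field_simps)
  have wc: "continuous_on {0..l} w"
    unfolding w_def by (intro continuous_on_compose2[OF continuous_cs[of UNIV]] continuous_intros) auto
  define g where "g s = z s / w s" for s
  have gc: "continuous_on {0..l} g"
    unfolding g_def using w by (intro continuous_intros cont wc) force
  obtain t1 where t1: "t1 \<in> {0..l}" "\<And>s. s \<in> {0..l} \<Longrightarrow> g t1 \<le> g s"
    using continuous_attains_inf[OF compact_Icc _ gc] t by blast
  define m where "m = g t1"
  have m: "m < 0" using t1(2)[OF t] neg w[OF t] unfolding m_def g_def[of t] by (smt (verit) divide_neg_pos)
  let ?Z = "{s \<in> {0..l}. g s = m}"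
  define t0 where "t0 = Sup ?Z"
  have Z: "?Z \<noteq> {}" "bdd_above ?Z" using t1(1) by (auto simp: m_def intro!: bdd_aboveI[of _ l])
  have "t0 \<in> ?Z" unfolding t0_def
    by (intro closed_contains_Sup Z continuous_closed_preimage_constant gc) simp
  then have t0: "t0 \<in> {0..l}" "g t0 = m" by auto
  have last: "g s \<noteq> m" if "s \<in> {0..l}" "t0 < s" for s
    using cSup_upper[of s ?Z] Z that unfolding t0_def[symmetric] by auto
  have "g 0 \<ge> 0" "g l \<ge> 0" unfolding g_def using ends w[of 0] w[of l] l by auto
  then have "t0 \<noteq> 0" "t0 \<noteq> l" using t0(2) m by auto
  with t0(1) have int: "0 < t0" "t0 < l" by auto
  from barrier[OF this] obtain B \<epsilon> where B: "0 < \<epsilon>" "\<And>h. \<bar>h\<bar> < \<epsilon> \<Longrightarrow> z (t0 + h) \<le> cs k h * z t0 + B * sn k h" by blast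
  have zw: "m * w s \<le> z s" if "s \<in> {0..l}" for s
    using t1(2)[OF that] w[OF that] unfolding m_def[symmetric] g_def[of s] by (simp add: pos_le_divide_eq)
  have zt0: "z t0 = m * w t0" using t0(2) w[OF t0(1)] by (simp add: g_def field_simps)
  define D where "D = B + m * (k * sn k (t0 - l / 2))"
  \<comment> \<open>Both \<open>w\<close> and the barrier are combinations of \<open>cs k h\<close> and \<open>sn k h\<close>, and the terms with \<open>cs k h\<close> cancel.\<close>
  have key: "z (t0 + h) - m * w (t0 + h) \<le> D * sn k h" if "\<bar>h\<bar> < \<epsilon>" for h
  proof -
    have wh: "w (t0 + h) = cs k h * w t0 - k * (sn k (t0 - l / 2) * sn k h)"
      using cs_add[of k "t0 - l / 2" h] by (simp add: w_def algebra_simps)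
    show ?thesis using B(2)[OF that] unfolding wh by (simp add: zt0 D_def algebra_simps)
  qed
  define \<delta> where "\<delta> = min \<epsilon> (min t0 (l - t0)) / 2"
  have \<delta>: "0 < \<delta>" "\<delta> < \<epsilon>" "\<delta> < t0" "\<delta> < l - t0" using B(1) int by (auto simp: \<delta>_def min_def)
  have sn: "0 < sn k \<delta>" using \<delta> int by (intro sn_pos below_diameter_mono[OF l(2)]) auto
  have "0 \<le> D * sn k (- \<delta>)" "0 \<le> D * sn k \<delta>"
    using key[of "- \<delta>"] key[of \<delta>] zw[of "t0 + - \<delta>"] zw[of "t0 + \<delta>"] \<delta> int by auto
  then have "D * sn k \<delta> \<le> 0" by simp
  then have "z (t0 + \<delta>) = m * w (t0 + \<delta>)"
    using key[of \<delta>] zw[of "t0 + \<delta>"] \<delta> int by (intro antisym) auto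
  then have "g (t0 + \<delta>) = m"
    using w[of "t0 + \<delta>"] \<delta> int by (simp add: g_def)
  with last[of "t0 + \<delta>"] \<delta> int show False by simp
qed

text \<open>Moving from \<open>c u\<close> forwards or backwards, the distance to \<open>p\<close> is bounded by a model hinge. The slopes of
  the two bounds fit together because adjacent angles add up to at most \<open>\<pi>\<close>, so one function
  supports the distance from above on both sides.\<close>

lemma distance_barrier:
  fixes p :: "'a::metric_space"
  assumes geo: "\<And>x y :: 'a. \<exists>c. unit_speed c (dist x y) \<and> c 0 = x \<and> c (dist x y) = y"
    and loc: "\<And>x :: 'a. \<exists>\<epsilon>. comparison_ball k x \<epsilon>"
    and proper: "\<And>(a::'a) R. compact (cball a R)"
    and c: "unit_speed c l" and u: "0 < u" "u < l" and bl: "below_diameter k (dist p (c u))"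
  shows "\<exists>A \<epsilon>. 0 < \<epsilon> \<and> (\<forall>h. \<bar>h\<bar> < \<epsilon> \<longrightarrow>
    md k (dist p (c (u + h))) \<le> md k h + cs k h * md k (dist p (c u)) + A * sn k h)"
proof -
  define f where "f = dist p (c u)"
  define r where "r = min u (l - u)"
  have r: "0 < r" using u by (simp add: r_def)
  show ?thesis
  proof (cases "f = 0")
    case True
    have "dist p (c (u + h)) = \<bar>h\<bar>" if "\<bar>h\<bar> < r" for h
      using unit_speed_dist[OF c, of u "u + h"] that True u by (auto simp: f_def r_def abs_if split: if_splits)
    then show ?thesis using r True unfolding f_def
      by (intro exI[of _ 0] exI[of _ r]) simp
  next
    case False
    then have f: "0 < f" by (simp add: f_def)
    obtain \<alpha> where \<alpha>: "unit_speed \<alpha> f" "\<alpha> 0 = c u" "\<alpha> f = p"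
      using geo[of "c u" p] unfolding f_def by (auto simp: dist_commute)
    define C where "C = angle_cos k \<alpha> (\<lambda>t. c (u + t))"
    define D where "D = angle_cos k \<alpha> (\<lambda>t. c (u - t))"
    obtain \<epsilon>0 where "comparison_ball k (c u) \<epsilon>0" using loc by blast
    from angle_cos_adjacent[OF this \<alpha>(1,2) f c refl u] have CD: "- C \<le> D"
      by (simp add: C_def D_def)
    define \<epsilon> where "\<epsilon> = min r (if k > 0 then pi / sqrt k - f else 1)"
    have \<epsilon>: "0 < \<epsilon>" using r bl by (auto simp: \<epsilon>_def below_diameter_def f_def)
    have bel: "below_diameter k (f + t)" if "t < \<epsilon>" for t using that by (auto simp: \<epsilon>_def below_diameter_def)
    have "md k (dist p (c (u + h))) \<le> md k h + cs k h * md k f + (- sn k f * C) * sn k h" if h: "\<bar>h\<bar> < \<epsilon>" for h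
    proof -
      consider "h = 0" | "h > 0" | "h < 0" by linarith
      then show ?thesis
      proof cases
        case 1
        then show ?thesis by (simp add: f_def)
      next
        case 2
        have g: "unit_speed (\<lambda>t. c (u + t)) h" using h 2 u by (intro unit_speed_shift[OF c]) (auto simp: \<epsilon>_def r_def)
        have "md k (dist p (c (u + h))) \<le> md k (f + h) - sn k f * sn k h * (1 + C)"
          using hinge_comparison[OF geo loc proper \<alpha>(1) g _ f 2 bel] \<alpha> h by (simp add: C_def)
        then show ?thesis by (simp add: md_add algebra_simps)
      next
        case 3
        define t where "t = - h"
        have t: "0 < t" "t < \<epsilon>" "h = - t" using 3 h by (auto simp: t_def)
        have g: "unit_speed (\<lambda>v. c (u - v)) t"
          using unit_speed_mono[OF unit_speed_reverse[OF c, of u], of t] t u by (auto simp: \<epsilon>_def r_def)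
        have "md k (dist p (c (u - t))) \<le> md k (f + t) - sn k f * sn k t * (1 + D)"
          using hinge_comparison[OF geo loc proper \<alpha>(1) g _ f t(1) bel[OF t(2)]] \<alpha> by (simp add: D_def)
        also have "\<dots> \<le> md k (f + t) - sn k f * sn k t * (1 - C)"
        proof -
          have "0 \<le> sn k f * sn k t"
            using f t bel[OF t(2)] by (intro mult_nonneg_nonneg sn_nonneg) (auto elim: below_diameter_mono)
          then have "sn k f * sn k t * (1 - C) \<le> sn k f * sn k t * (1 + D)"
            using CD by (intro mult_left_mono) auto
          then show ?thesis by simp
        qed
        finally show ?thesis by (simp add: t(3) md_add algebra_simps)
      qed
    qed
    then show ?thesis using \<epsilon> unfolding f_def by blast
  qed
qed

text \<open>The function \<open>\<psi>\<close> in the proof is the solution of \<open>y'' + k y = 1\<close> that agrees with \<open>md\<close> of the distance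
  to \<open>p\<close> at both ends of \<open>c\<close>.\<close>

lemma toponogov_stewart:
  fixes p :: "'a::metric_space"
  assumes geo: "\<And>x y :: 'a. \<exists>c. unit_speed c (dist x y) \<and> c 0 = x \<and> c (dist x y) = y"
    and loc: "\<And>x :: 'a. \<exists>\<epsilon>. comparison_ball k x \<epsilon>"
    and proper: "\<And>(a::'a) R. compact (cball a R)"
    and c: "unit_speed c (t + e)" and te: "0 \<le> t" "0 \<le> e" "0 < t + e" and bl: "below_diameter k (t + e)"
    and far: "\<And>v. v \<in> {0..t + e} \<Longrightarrow> below_diameter k (dist p (c v))"
  shows "stewart_le k p c t e"
proof -
  define l where "l = t + e"
  define \<phi> where "\<phi> v = md k (dist p (c v))" for v
  have sn: "0 < sn k l" unfolding l_def using te bl by (intro sn_pos) auto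
  define A where "A = (\<phi> l - md k l - cs k l * \<phi> 0) / sn k l"
  have A: "A * sn k l = \<phi> l - md k l - cs k l * \<phi> 0" using sn by (simp add: A_def)
  define \<psi> where "\<psi> v = md k v + cs k v * \<phi> 0 + A * sn k v" for v
  have \<psi>_shift: "\<psi> (v + h) = md k h + cs k h * \<psi> v + (sn k v - k * sn k v * \<phi> 0 + A * cs k v) * sn k h" for v h
    unfolding \<psi>_def cs_add sn_add md_add by (simp add: algebra_simps)
  have "continuous_on {0..l} c"
    unfolding continuous_on_iff using unit_speed_dist[OF c] by (force simp: l_def dist_real_def)
  then have "continuous_on {0..l} \<phi>"
    unfolding \<phi>_def by (intro continuous_on_compose2[OF continuous_md[of UNIV]] continuous_intros) auto
  then have cont: "continuous_on {0..l} (\<lambda>v. \<phi> v - \<psi> v)"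
    unfolding \<psi>_def by (intro continuous_intros continuous_md continuous_sn continuous_cs)
  have "0 \<le> \<phi> t - \<psi> t"
  proof (rule barrier_nonneg[where z = "\<lambda>v. \<phi> v - \<psi> v", OF cont])
    show "0 < l" "below_diameter k l" "t \<in> {0..l}" using te bl by (auto simp: l_def)
    show "0 \<le> \<phi> 0 - \<psi> 0" "0 \<le> \<phi> l - \<psi> l" using A by (simp_all add: \<psi>_def)
    fix v assume v: "0 < v" "v < l"
    obtain A' \<epsilon> where *: "0 < \<epsilon>" "\<And>h. \<bar>h\<bar> < \<epsilon> \<Longrightarrow> \<phi> (v + h) \<le> md k h + cs k h * \<phi> v + A' * sn k h"
      using distance_barrier[OF geo loc proper c, of v p] v far[of v] unfolding \<phi>_def l_def by auto
    show "\<exists>B \<epsilon>. 0 < \<epsilon> \<and> (\<forall>h. \<bar>h\<bar> < \<epsilon> \<longrightarrow> \<phi> (v + h) - \<psi> (v + h) \<le> cs k h * (\<phi> v - \<psi> v) + B * sn k h)"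
    proof (intro exI conjI allI impI)
      fix h assume "\<bar>h\<bar> < \<epsilon>"
      from *(2)[OF this] show "\<phi> (v + h) - \<psi> (v + h) \<le> cs k h * (\<phi> v - \<psi> v)
          + (A' - (sn k v - k * sn k v * \<phi> 0 + A * cs k v)) * sn k h"
        unfolding \<psi>_shift by (simp add: algebra_simps)
    qed (rule *(1))
  qed
  then have "sn k l * \<psi> t \<le> sn k l * \<phi> t" using sn by (intro mult_left_mono) auto
  moreover have "sn k l * \<psi> t = sn k e * (\<phi> 0 - md k t) + sn k t * (\<phi> l - md k e)"
  proof -
    have "sn k l * \<psi> t = sn k l * (md k t + cs k t * \<phi> 0) + sn k t * (\<phi> l - md k l - cs k l * \<phi> 0)"
      unfolding A[symmetric] by (simp add: \<psi>_def algebra_simps)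
    also have "\<dots> = sn k e * (\<phi> 0 - md k t) + sn k t * (\<phi> l - md k e)"
    proof -
      have "(sn k t)\<^sup>2 = 2 * md k t - k * (md k t)\<^sup>2" by (rule sn_square)
      then show ?thesis unfolding l_def sn_add cs_md md_add by algebra
    qed
    finally show ?thesis .
  qed
  ultimately show ?thesis unfolding stewart_le_def \<phi>_def l_def by simp
qed

section \<open>The comparison theorem\<close>

theorem theoremB:
  fixes k :: real
    and p q r s :: "'a :: metric_space"
    and S :: "'a set"
    and p' q' r' s' :: "real^3"
    and S' :: "(real^3) set"
  assumes "complete (UNIV :: 'a set)"
    and "alexandrov_space k (UNIV :: 'a set) dist"
    and "min_geodesic UNIV dist q r S"
    and "p' \<in> model_plane k"
    and "min_geodesic (model_plane k) (model_dist k) q' r' S'"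
    and "model_dist k p' q' = dist p q"
    and "model_dist k p' r' = dist p r"
    and "model_dist k q' r' = dist q r"
    and "k > 0 \<Longrightarrow> dist p q + dist p r + dist q r < 2 * pi / sqrt k"
    and "s \<in> S"
    and "s' \<in> S'"
    and "dist q s = model_dist k q' s'"
  shows "dist p s \<ge> model_dist k p' s'"
proof -
  interpret model: Metric_space "model_plane k" "model_dist k" by (rule Metric_space_model)
  note m = model.min_geodesic_between[OF assms(5,11)]
  have ls: "length_space (UNIV :: 'a set) dist"
    and lc: "locally_compact_space (Metric_space.mtopology (UNIV :: 'a set) dist)"
    using assms(2) by (simp_all add: alexandrov_space_def)
  have proper: "compact (cball a R)" for a :: 'a and R
    by (rule hopf_rinow_proper[OF assms(1) ls lc])
  have mid: "\<exists>z. dist x z = dist x y / 2 \<and> dist z y = dist x y / 2" for x y :: 'a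
    using midpoint_exists[OF ls proper] by metis
  have geo: "\<exists>c. unit_speed c (dist x y) \<and> c 0 = x \<and> c (dist x y) = y" for x y :: 'a
    using geodesic_exists[OF assms(1) mid] by metis
  have loc: "\<exists>\<epsilon>. comparison_ball k x \<epsilon>" for x :: 'a
    by (rule alexandrov_comparison_ball[OF assms(2)])
  obtain c where c: "unit_speed c (dist q r)" "c 0 = q" "c (dist q r) = r" "S = c ` {0..dist q r}"
    using min_geodesic_imp_unit_speed[OF assms(3)] .
  then obtain t where t: "0 \<le> t" "t \<le> dist q r" "s = c t" using assms(10) by auto
  define e where "e = dist q r - t"
  have te: "t + e = dist q r" "0 \<le> e" using t by (auto simp: e_def)
  have qs: "dist q s = t" using unit_speed_dist[OF c(1), of 0 t] t c(2) by simp
  show ?thesis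
  proof (cases "dist q r = 0")
    case True
    then have "q = s" using t qs by simp
    then have "s' = q'" using assms(12) m by simp
    then show ?thesis using assms(6) \<open>q = s\<close> by simp
  next
    case False
    \<comment> \<open>Half the perimeter bounds \<open>|qr|\<close> and all distances from \<open>p\<close> to points of \<open>[qr]\<close>.\<close>
    have half: "dist p (c v) \<le> (dist p q + dist p r + dist q r) / 2" if "v \<in> {0..dist q r}" for v
      using that dist_triangle[of p "c v" q] dist_triangle[of p "c v" r]
        unit_speed_dist[OF c(1), of 0 v] unit_speed_dist[OF c(1), of "dist q r" v] c(2,3)
      by (auto simp: field_simps)
    have bel: "below_diameter k x" if "x \<le> (dist p q + dist p r + dist q r) / 2" for x
    proof -
      have "2 * x \<le> dist p q + dist p r + dist q r" using that by simp
      moreover have "2 * pi / sqrt k = 2 * (pi / sqrt k)" by simp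
      ultimately show ?thesis using assms(9) unfolding below_diameter_def by linarith
    qed
    have qr: "below_diameter k (t + e)"
      using dist_triangle[of q r p] unfolding te(1) by (intro bel) (simp add: dist_commute field_simps)
    have "stewart_le k p c t e"
    proof (rule toponogov_stewart[OF geo loc proper])
      show "below_diameter k (t + e)" by (rule qr)
      show "0 < t + e" using False te by simp
      show "below_diameter k (dist p (c v))" if "v \<in> {0..t + e}" for v
        using half that te by (intro bel) auto
    qed (use c t te in auto)
    moreover have "sn k (t + e) * md k (model_dist k p' s')
      = sn k e * (md k (model_dist k p' q') - md k t) + sn k t * (md k (model_dist k p' r') - md k e)"
      using m assms(4,8,12) te qs by (intro stewart_model) auto
    ultimately have "sn k (t + e) * md k (model_dist k p' s') \<le> sn k (t + e) * md k (dist p s)"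
      using c te t(3) assms(6,7) by (simp add: stewart_le_def)
    moreover have "0 < sn k (t + e)" using False te qr by (intro sn_pos) auto
    ultimately have "md k (model_dist k p' s') \<le> md k (dist p s)" by simp
    moreover have "below_diameter k (dist p s)" using half[of t] t by (intro bel) auto
    then have "k > 0 \<Longrightarrow> dist p s \<le> pi / sqrt k" by (simp add: below_diameter_def)
    ultimately show ?thesis
      using md_le_iff[of "model_dist k p' s'" "dist p s" k] model_dist_bounds[of p' k s'] assms(4) m
      by simp
  qed
qed

end
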